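(* Let $T>0$, $1<p<\infty$, $0<\alpha<\frac1p$, let $f\in C([0,T]\times\mathbb{R},\mathbb{R})$ and put $F(t,u)=\int_0^uf(t,s)\,ds$. Assume that the functional $$I(u)=\frac1p\int_0^T|{}_0D_t^\alpha u(t)|^p\,dt-\int_0^TF(t,u(t))\,dt$$ is well defined and of class $C^1$ on $E_0^{\alpha,p}$, with $$I'(u)v=\int_0^T|{}_0D_t^\alpha u|^{p-2}{}_0D_t^\alpha u\;{}_0D_t^\alpha v\,dt-\int_0^Tf(t,u(t))v(t)\,dt\quad\text{for all }u,v\in E_0^{\alpha,p}.$$ Then any critical point $u$ of $I$ on $E_0^{\alpha,p}$ is an almost everywhere solution on $[0,T]$ of $${}_tD_T^{\alpha}\left(|{}_0D_t^{\alpha}u(t)|^{p-2}{}_0D_t^{\alpha}u(t)\right)=f(t,u(t)),\qquad u(0)=u(T)=0,$$ that is, $u\in E_0^{\alpha,p}$ and the displayed differential equation holds for almost every $t\in[0,T]$.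
   Context: For $0<\alpha<1$: the left and right Riemann-Liouville fractional integrals of order $\beta>0$ on $[0,T]$ are ${}_0I_t^{\beta}u(t)=\frac1{\Gamma(\beta)}\int_0^t(t-s)^{\beta-1}u(s)\,ds$ and ${}_tI_T^{\beta}u(t)=\frac1{\Gamma(\beta)}\int_t^T(s-t)^{\beta-1}u(s)\,ds$; the left and right Riemann-Liouville fractional derivatives are ${}_0D_t^{\alpha}u=\frac{d}{dt}\,{}_0I_t^{1-\alpha}u$ and ${}_tD_T^{\alpha}u=-\frac{d}{dt}\,{}_tI_T^{1-\alpha}u$. The fractional derivative space $E_0^{\alpha,p}$ is the closure of $C_0^\infty[0,T]$ (smooth functions vanishing at $0$ and $T$; using compactly supported smooth functions in $(0,T)$ gives the same closure) with respect to the norm $\left(\int_0^T|u|^p\,dt+\int_0^T|{}_0D_t^\alpha u|^p\,dt\right)^{1/p}$; its elements are functions $u\in L^p[0,T]$ with ${}_0D_t^\alpha u\in L^p[0,T]$, the boundary condition $u(0)=u(T)=0$ being encoded in membership in this space. An equivalent norm on it is $\|u\|_{\alpha,p}=\|{}_0D_t^\alpha u\|_{L^p[0,T]}$. A critical point of $I$ is a $u\in E_0^{\alpha,p}$ with $I'(u)v=0$ for all $v\in E_0^{\alpha,p}$. The expression $|x|^{p-2}x$ is read as $0$ at $x=0$. *)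

theory Defs
  imports "HOL-Analysis.Analysis"
begin

text \<open>
  Functions on \<open>[0,T]\<close> are represented by functions \<open>real \<Rightarrow> real\<close> whose values outside
  \<open>[0,T]\<close> are irrelevant. Integrals are taken with respect to the complete measure
  \<^const>\<open>lebesgue\<close>, because elements of \<open>L\<^sup>p[0,T]\<close> are Lebesgue measurable functions.
\<close>

definition rl_left_int :: "real \<Rightarrow> (real \<Rightarrow> real) \<Rightarrow> real \<Rightarrow> real" where
  "rl_left_int \<beta> u t =
     1 / Gamma \<beta> * (LINT s:{0..t}|lebesgue. (t - s) powr (\<beta> - 1) * u s)"

definition rl_right_int :: "real \<Rightarrow> real \<Rightarrow> (real \<Rightarrow> real) \<Rightarrow> real \<Rightarrow> real" where
  "rl_right_int T \<beta> u t =
     1 / Gamma \<beta> * (LINT s:{t..T}|lebesgue. (s - t) powr (\<beta> - 1) * u s)"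

definition rl_left_deriv :: "real \<Rightarrow> (real \<Rightarrow> real) \<Rightarrow> real \<Rightarrow> real" where
  "rl_left_deriv \<alpha> u t = deriv (rl_left_int (1 - \<alpha>) u) t"

definition rl_right_deriv :: "real \<Rightarrow> real \<Rightarrow> (real \<Rightarrow> real) \<Rightarrow> real \<Rightarrow> real" where
  "rl_right_deriv T \<alpha> u t = - deriv (rl_right_int T (1 - \<alpha>) u) t"

text \<open>
  Both \<^const>\<open>deriv\<close> and the Bochner integral are total, so existence of the fractional
  derivative at a point is stated separately: the integral converges for all points near
  \<open>t\<close>, and as a function of its endpoint it is classically differentiable at \<open>t\<close>.
\<close>

definition rl_left_differentiable :: "real \<Rightarrow> (real \<Rightarrow> real) \<Rightarrow> real \<Rightarrow> bool" where
  "rl_left_differentiable \<alpha> u t \<longleftrightarrow>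
     (\<forall>\<^sub>F r in nhds t. set_integrable lebesgue {0..r} (\<lambda>s. (r - s) powr (- \<alpha>) * u s)) \<and>
     rl_left_int (1 - \<alpha>) u differentiable at t"

definition rl_right_differentiable :: "real \<Rightarrow> real \<Rightarrow> (real \<Rightarrow> real) \<Rightarrow> real \<Rightarrow> bool" where
  "rl_right_differentiable T \<alpha> u t \<longleftrightarrow>
     (\<forall>\<^sub>F r in nhds t. set_integrable lebesgue {r..T} (\<lambda>s. (s - r) powr (- \<alpha>) * u s)) \<and>
     rl_right_int T (1 - \<alpha>) u differentiable at t"

definition in_Lp :: "real \<Rightarrow> real \<Rightarrow> (real \<Rightarrow> real) \<Rightarrow> bool" where
  "in_Lp T p u \<longleftrightarrow>
     set_borel_measurable lebesgue {0..T} u \<and>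
     set_integrable lebesgue {0..T} (\<lambda>t. \<bar>u t\<bar> powr p)"

text \<open>
  Smoothness on the closed interval: \<open>d n\<close> is the \<open>n\<close>-th derivative, one-sided at the
  end points.
\<close>

definition C0_infinity :: "real \<Rightarrow> (real \<Rightarrow> real) set" where
  "C0_infinity T = {\<phi>. \<phi> 0 = 0 \<and> \<phi> T = 0 \<and>
     (\<exists>d :: nat \<Rightarrow> real \<Rightarrow> real. (\<forall>t\<in>{0..T}. d 0 t = \<phi> t) \<and>
        (\<forall>n. \<forall>t\<in>{0..T}. (d n has_real_derivative d (Suc n) t) (at t within {0..T})))}"

definition frac_norm :: "real \<Rightarrow> real \<Rightarrow> real \<Rightarrow> (real \<Rightarrow> real) \<Rightarrow> real" where
  "frac_norm T \<alpha> p u =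
     ((LINT t:{0..T}|lebesgue. \<bar>u t\<bar> powr p)
      + (LINT t:{0..T}|lebesgue. \<bar>rl_left_deriv \<alpha> u t\<bar> powr p)) powr (1 / p)"

text \<open>
  The closure is taken among the functions \<open>u \<in> L\<^sup>p\<close> having a fractional derivative almost
  everywhere which belongs to \<open>L\<^sup>p\<close>. Functions that agree almost everywhere are not
  identified, so \<^const>\<open>frac_norm\<close> is only a seminorm on this set.
\<close>

definition frac_space :: "real \<Rightarrow> real \<Rightarrow> real \<Rightarrow> (real \<Rightarrow> real) set" where
  "frac_space T \<alpha> p = {u. in_Lp T p u \<and>
     (AE t in lebesgue. t \<in> {0..T} \<longrightarrow> rl_left_differentiable \<alpha> u t) \<and>
     in_Lp T p (rl_left_deriv \<alpha> u) \<and>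
     (\<forall>\<epsilon>>0. \<exists>\<phi>\<in>C0_infinity T. frac_norm T \<alpha> p (\<lambda>t. u t - \<phi> t) < \<epsilon>)}"

text \<open>
  Frechet differentiability of \<open>J\<close> at \<open>u\<close> with derivative \<open>L\<close>, and continuous
  differentiability, on a linear space \<open>E\<close> of functions with a seminorm \<open>N\<close>. Continuity of
  the derivative refers to the operator norm on the dual of \<open>E\<close>.
\<close>

definition frechet_deriv_on ::
  "(real \<Rightarrow> real) set \<Rightarrow> ((real \<Rightarrow> real) \<Rightarrow> real) \<Rightarrow> ((real \<Rightarrow> real) \<Rightarrow> real) \<Rightarrow>
   (real \<Rightarrow> real) \<Rightarrow> ((real \<Rightarrow> real) \<Rightarrow> real) \<Rightarrow> bool" where
  "frechet_deriv_on E N J u L \<longleftrightarrow>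
     (\<forall>v\<in>E. \<forall>w\<in>E. \<forall>a b. L (\<lambda>t. a * v t + b * w t) = a * L v + b * L w) \<and>
     (\<exists>C. \<forall>v\<in>E. \<bar>L v\<bar> \<le> C * N v) \<and>
     (\<forall>\<epsilon>>0. \<exists>\<delta>>0. \<forall>v\<in>E. N v < \<delta> \<longrightarrow> \<bar>J (\<lambda>t. u t + v t) - J u - L v\<bar> \<le> \<epsilon> * N v)"

definition C1_on ::
  "(real \<Rightarrow> real) set \<Rightarrow> ((real \<Rightarrow> real) \<Rightarrow> real) \<Rightarrow> ((real \<Rightarrow> real) \<Rightarrow> real) \<Rightarrow>
   ((real \<Rightarrow> real) \<Rightarrow> (real \<Rightarrow> real) \<Rightarrow> real) \<Rightarrow> bool" where
  "C1_on E N J J' \<longleftrightarrow>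
     (\<forall>u\<in>E. frechet_deriv_on E N J u (J' u)) \<and>
     (\<forall>u\<in>E. \<forall>\<epsilon>>0. \<exists>\<delta>>0. \<forall>w\<in>E. N (\<lambda>t. w t - u t) < \<delta> \<longrightarrow>
        (\<forall>v\<in>E. \<bar>J' w v - J' u v\<bar> \<le> \<epsilon> * N v))"

text \<open>The value at \<open>0\<close> is \<open>0\<close>, also for \<open>p < 2\<close>.\<close>

definition signed_power :: "real \<Rightarrow> real \<Rightarrow> real" where
  "signed_power p x = \<bar>x\<bar> powr (p - 2) * x"

definition primitive :: "(real \<Rightarrow> real \<Rightarrow> real) \<Rightarrow> real \<Rightarrow> real \<Rightarrow> real" where
  "primitive f t x = (LBINT s=0..x. f t s)"

definition energy ::
  "real \<Rightarrow> real \<Rightarrow> real \<Rightarrow> (real \<Rightarrow> real \<Rightarrow> real) \<Rightarrow> (real \<Rightarrow> real) \<Rightarrow> real" where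
  "energy T \<alpha> p f u =
     1 / p * (LINT t:{0..T}|lebesgue. \<bar>rl_left_deriv \<alpha> u t\<bar> powr p)
     - (LINT t:{0..T}|lebesgue. primitive f t (u t))"

text \<open>
  Almost everywhere solutions; the boundary condition \<open>u(0) = u(T) = 0\<close> is encoded in the
  membership in \<^const>\<open>frac_space\<close>.
\<close>

definition ae_solution ::
  "real \<Rightarrow> real \<Rightarrow> real \<Rightarrow> (real \<Rightarrow> real \<Rightarrow> real) \<Rightarrow> (real \<Rightarrow> real) \<Rightarrow> bool" where
  "ae_solution T \<alpha> p f u \<longleftrightarrow>
     u \<in> frac_space T \<alpha> p \<and>
     (AE t in lebesgue. t \<in> {0..T} \<longrightarrow>
        rl_right_differentiable T \<alpha> (\<lambda>s. signed_power p (rl_left_deriv \<alpha> u s)) t \<and>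
        rl_right_deriv T \<alpha> (\<lambda>s. signed_power p (rl_left_deriv \<alpha> u s)) t = f t (u t))"

end

theory Submission
  imports Defs
begin

text \<open>
  Put \<open>w = |D u|\<^sup>p\<^sup>-\<^sup>2 D u\<close> and \<open>J = \<^sub>tI\<^sub>T\<^sup>1\<^sup>-\<^sup>\<alpha> w\<close>, where \<open>D\<close> is the left derivative of order \<open>\<alpha>\<close>.
  Because \<open>\<alpha> p < 1\<close>, the kernel \<open>x\<^sup>-\<^sup>\<alpha>\<close> is in \<open>L\<^sup>p\<close> near \<open>0\<close>, so \<open>J\<close> exists everywhere and is
  continuous. It suffices to test \<open>I'(u) = 0\<close> with the polynomials \<open>\<phi>(t) = t (T - t) t\<^sup>n\<close>: for these
  \<open>D \<phi>\<close> is the fractional integral of \<open>\<phi>'\<close>, so Fubini gives \<open>\<integral> J \<phi>' = \<integral> f(t, u) \<phi>\<close>. With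
  \<open>K = t (T - t) J\<close> and \<open>k = (T - 2 t) J - t (T - t) f(t, u)\<close> this says that \<open>K\<close> and the
  indefinite integral of \<open>k\<close> have the same moments. Both are continuous, hence equal, and Lebesgue's
  differentiation theorem yields \<open>K' = k\<close>, that is \<open>- J' = f(t, u)\<close>, almost everywhere.
\<close>

subsection \<open>Lebesgue's differentiation theorem\<close>

text \<open>
  Vitali's covering theorem extracts disjoint bad intervals covering almost all of \<open>S\<close>. Tagged by
  their points of \<open>S\<close> they form a partial division, so Henstock's lemma bounds their total length.
\<close>

lemma negligible_vitali_tagged:
  fixes f :: "real \<Rightarrow> 'a::euclidean_space"
  assumes int: "f integrable_on {a..b}" and "c > 0"
    and S: "\<And>x d. x \<in> S \<Longrightarrow> d > 0 \<Longrightarrow>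
      \<exists>u v. u < v \<and> v - u < d \<and> x \<in> {u..v} \<and> {u..v} \<subseteq> {a..b} \<and>
        c * (v - u) \<le> norm ((v - u) *\<^sub>R f x - integral {u..v} f)"
  shows "negligible S"
  unfolding negligible_outer_le
proof (intro allI impI)
  fix e :: real assume "e > 0"
  then have "c * e > 0" using \<open>c > 0\<close> by simp
  obtain \<gamma> where \<gamma>: "gauge \<gamma>" and hen: "\<And>p. \<lbrakk>p tagged_partial_division_of {a..b}; \<gamma> fine p\<rbrakk> \<Longrightarrow>
      (\<Sum>(x, K)\<in>p. norm (measure lborel K *\<^sub>R f x - integral K f)) < c * e"
  proof (rule Henstock_lemma[OF int[folded box_real(2)] \<open>c * e > 0\<close>])
    fix \<gamma> assume g: "gauge \<gamma>" and h: "\<And>p. \<lbrakk>p tagged_partial_division_of cbox a b; \<gamma> fine p\<rbrakk> \<Longrightarrow>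
      (\<Sum>(x, K)\<in>p. norm (measure lborel K *\<^sub>R f x - integral K f)) < c * e"
    show thesis by (rule that[OF g h[unfolded box_real(2)]])
  qed
  \<comment> \<open>A tagged interval is coded as a triple \<open>(x, u, v)\<close>.
    \<open>A\<close> and \<open>R\<close> give the centre and the radius of \<open>{u..v}\<close>,
    because Vitali's theorem is applied in its form for closed balls.\<close>
  define A where "A = (\<lambda>(x::real, u, v::real). (u + v) / 2)"
  define R where "R = (\<lambda>(x::real, u, v::real). (v - u) / 2)"
  define Q where "Q = {(x, u, v). u < v \<and> x \<in> {u..v} \<and> {u..v} \<subseteq> {a..b} \<and> {u..v} \<subseteq> \<gamma> x \<and>
    c * (v - u) \<le> norm ((v - u) *\<^sub>R f x - integral {u..v} f)}"
  have cb: "cball (A (x, u, v)) (R (x, u, v)) = {u..v}" for x u v :: real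
    by (auto simp: A_def R_def cball_eq_atLeastAtMost field_simps)
  have posR: "R i > 0" if "i \<in> Q" for i
    using that by (auto simp: Q_def R_def)
  obtain C where C: "countable C" "C \<subseteq> Q"
    and disj: "pairwise (\<lambda>i j. disjnt (cball (A i) (R i)) (cball (A j) (R j))) C"
    and neg: "negligible (S - (\<Union>i\<in>C. cball (A i) (R i)))"
  proof (rule Vitali_covering_theorem_cballs[of Q R S A])
    fix x d :: real assume x: "x \<in> S" "d > 0"
    have "open (\<gamma> x)" "x \<in> \<gamma> x" using \<gamma> by (auto simp: gauge_def)
    then obtain r where r: "r > 0" "ball x r \<subseteq> \<gamma> x" by (meson openE)
    obtain u v where uv: "u < v" "v - u < min d r" "x \<in> {u..v}" "{u..v} \<subseteq> {a..b}"
      "c * (v - u) \<le> norm ((v - u) *\<^sub>R f x - integral {u..v} f)"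
      using S[OF x(1), of "min d r"] x(2) r(1) by auto
    have "{u..v} \<subseteq> ball x r" using uv by (auto simp: dist_real_def)
    then have "(x, u, v) \<in> Q" using uv r by (auto simp: Q_def)
    moreover have "x \<in> cball (A (x, u, v)) (R (x, u, v))" using uv cb by simp
    moreover have "R (x, u, v) < d" using uv by (auto simp: R_def)
    ultimately show "\<exists>i. i \<in> Q \<and> x \<in> cball (A i) (R i) \<and> R i < d" by blast
  qed (auto simp: posR)
  \<comment> \<open>Finite subfamilies suffice: a common bound on the measures of all finite unions
    passes to the countable union. Henstock's lemma also speaks of finite families only.\<close>
  have bound: "measure lebesgue (\<Union>i\<in>D. cball (A i) (R i)) \<le> e" if D: "D \<subseteq> C" "finite D" for D
  proof -
    define p where "p = (\<lambda>(x, u, v). (x, {u..v})) ` D"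
    have DQ: "D \<subseteq> Q" using D C by auto
    have dis: "{u..v} \<inter> {u'..v'} = {}"
      if "(x, u, v) \<in> D" "(x', u', v') \<in> D" "(x, u, v) \<noteq> (x', u', v')" for x u v x' u' v'
    proof -
      have "disjnt (cball (A (x, u, v)) (R (x, u, v))) (cball (A (x', u', v')) (R (x', u', v')))"
        by (rule pairwiseD[OF disj]) (use that D(1) in auto)
      then show ?thesis by (simp only: cb disjnt_def)
    qed
    \<comment> \<open>As \<open>u < v\<close>, the set \<open>{u..v}\<close> determines its end
      points, so no summand is lost when the sum over \<open>p\<close> is written as a sum over
      \<open>D\<close>.\<close>
    have inj: "inj_on (\<lambda>(x, u, v). (x, {u..v})) D"
    proof (rule inj_onI)
      fix i j assume *: "i \<in> D" "j \<in> D" "(\<lambda>(x, u, v). (x, {u..v})) i = (\<lambda>(x, u, v). (x, {u..v})) j"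
      obtain x u v x' u' v' where ij: "i = (x, u, v)" "j = (x', u', v')" by (metis prod_cases3)
      have "u < v" "u' < v'" using * DQ by (auto simp: Q_def ij)
      then show "i = j" using *(3) by (simp add: ij Icc_eq_Icc)
    qed
    have "p tagged_partial_division_of {a..b}"
      unfolding tagged_partial_division_of_def
    proof (intro conjI allI impI)
      show "finite p" using D by (simp add: p_def)
    next
      fix x K assume "(x, K) \<in> p"
      then obtain u v where K: "(x, u, v) \<in> D" "K = {u..v}" by (auto simp: p_def)
      then have "(x, u, v) \<in> Q" using DQ by auto
      then show "x \<in> K" "K \<subseteq> {a..b}" "\<exists>a b. K = cbox a b"
        using K by (auto simp: Q_def box_real)
    next
      fix x1 K1 x2 K2
      assume *: "(x1, K1) \<in> p \<and> (x2, K2) \<in> p \<and> (x1, K1) \<noteq> (x2, K2)"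
      then obtain u v u' v' where "(x1, u, v) \<in> D" "K1 = {u..v}" "(x2, u', v') \<in> D" "K2 = {u'..v'}"
        unfolding p_def by auto
      then have "K1 \<inter> K2 = {}" using * dis by blast
      then show "interior K1 \<inter> interior K2 = {}" using interior_subset by blast
    qed
    moreover have "\<gamma> fine p" using DQ by (auto simp: fine_def p_def Q_def)
    ultimately have h: "(\<Sum>(x, K)\<in>p. norm (measure lborel K *\<^sub>R f x - integral K f)) < c * e" by (rule hen)
    have "measure lebesgue (\<Union>i\<in>D. cball (A i) (R i)) \<le> (\<Sum>i\<in>D. measure lebesgue (cball (A i) (R i)))"
      by (rule measure_UNION_le) (use D in auto)
    also have "\<dots> = (\<Sum>(x, u, v)\<in>D. v - u)"
    proof (rule sum.cong[OF refl])
      fix i assume "i \<in> D"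
      then show "measure lebesgue (cball (A i) (R i)) = (case i of (x, u, v) \<Rightarrow> v - u)"
        using DQ by (cases i) (auto simp: cb Q_def)
    qed
    finally have 1: "measure lebesgue (\<Union>i\<in>D. cball (A i) (R i)) \<le> (\<Sum>(x, u, v)\<in>D. v - u)" .
    \<comment> \<open>Every bad interval contributes at least \<open>c\<close> times its length to
      Henstock's sum, which is below \<open>c * e\<close>.\<close>
    have "c * (\<Sum>(x, u, v)\<in>D. v - u) = (\<Sum>(x, u, v)\<in>D. c * (v - u))"
      by (simp add: sum_distrib_left case_prod_unfold)
    also have "\<dots> \<le> (\<Sum>(x, u, v)\<in>D. norm (measure lborel {u..v} *\<^sub>R f x - integral {u..v} f))"
      using DQ by (intro sum_mono) (auto simp: Q_def)
    also have "\<dots> = (\<Sum>(x, K)\<in>p. norm (measure lborel K *\<^sub>R f x - integral K f))"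
      unfolding p_def by (subst sum.reindex[OF inj]) (simp add: case_prod_unfold)
    also note h
    finally show ?thesis using 1 \<open>c > 0\<close> by simp
  qed
  have m: "(\<Union>i\<in>C. cball (A i) (R i)) \<in> lmeasurable" "measure lebesgue (\<Union>i\<in>C. cball (A i) (R i)) \<le> e"
    using fmeasurable_UN_bound[OF C(1) _ bound] measure_UN_bound[OF C(1) _ bound] by auto
  let ?U = "(\<Union>i\<in>C. cball (A i) (R i))"
  have "S \<subseteq> ?U \<union> (S - ?U)" by auto
  moreover have "?U \<union> (S - ?U) \<in> lmeasurable"
    by (rule fmeasurable.Un[OF m(1) negligible_imp_measurable[OF neg]])
  moreover have "measure lebesgue (?U \<union> (S - ?U)) \<le> e"
    using measure_Un_null_set[of ?U lebesgue "S - ?U"] m neg by (auto simp: negligible_iff_null_sets fmeasurableD)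
  ultimately show "\<exists>T. S \<subseteq> T \<and> T \<in> lmeasurable \<and> measure lebesgue T \<le> e" by blast
qed

text \<open>If the derivative fails to be \<open>f x\<close> at an interior point, then for some
  \<open>c = inverse (Suc n)\<close> arbitrarily short intervals containing \<open>x\<close> have a
  mean value of \<open>f\<close> at distance at least \<open>c\<close> from \<open>f x\<close>. For
  each \<open>n\<close> such points form a negligible set by Vitali and Henstock, and a countable
  union of negligible sets is negligible.\<close>

theorem lebesgue_differentiation:
  fixes f :: "real \<Rightarrow> 'a::euclidean_space"
  assumes int: "f integrable_on {a..b}"
  obtains N where "negligible N" "N \<subseteq> {a<..<b}"
    "\<And>x. x \<in> {a<..<b} - N \<Longrightarrow>
      ((\<lambda>y. integral {a..y} f) has_vector_derivative f x) (at x)"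
proof
  define bad where "bad c = {x \<in> {a<..<b}. \<forall>d>0.
      \<exists>u v. u < v \<and> v - u < d \<and> x \<in> {u..v} \<and> {u..v} \<subseteq> {a..b} \<and>
        c * (v - u) \<le> norm ((v - u) *\<^sub>R f x - integral {u..v} f)}" for c :: real
  define N where "N = (\<Union>n. bad (inverse (Suc n)))"
  have "negligible (bad (inverse (Suc n)))" for n
    by (rule negligible_vitali_tagged[OF int, of "inverse (Suc n)"]) (simp_all add: bad_def del: of_nat_Suc)
  then show "negligible N" unfolding N_def by (rule negligible_Union_nat)
  show "N \<subseteq> {a<..<b}" by (auto simp: N_def bad_def)
  fix x assume x: "x \<in> {a<..<b} - N"
  let ?F = "\<lambda>y. integral {a..y} f"
  have comb: "?F v - ?F u = integral {u..v} f" if "a \<le> u" "u \<le> v" "v \<le> b" for u v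
  proof -
    have "f integrable_on {a..v}" using int integrable_on_subinterval that by fastforce
    then show ?thesis using Henstock_Kurzweil_Integration.integral_combine[of a u v f] that by (simp add: algebra_simps)
  qed
  show "(?F has_vector_derivative f x) (at x)"
    unfolding has_vector_derivative_def has_derivative_within_alt
  proof (intro conjI allI impI bounded_linear_scaleR_left)
    fix e :: real assume "e > 0"
    then obtain n where n: "inverse (real (Suc n)) < e" using reals_Archimedean by blast
    have "x \<notin> bad (inverse (Suc n))" using x by (auto simp: N_def)
    then obtain d where d: "d > 0" and nb: "\<And>u v. u < v \<Longrightarrow> v - u < d \<Longrightarrow> x \<in> {u..v} \<Longrightarrow> {u..v} \<subseteq> {a..b} \<Longrightarrow>
        norm ((v - u) *\<^sub>R f x - integral {u..v} f) < inverse (Suc n) * (v - u)"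
      using x unfolding bad_def mem_Collect_eq by (meson DiffD1 not_le)
    \<comment> \<open>Within distance \<open>r\<close> of \<open>x\<close>, the interval between
      \<open>x\<close> and \<open>y\<close> is shorter than \<open>d\<close> and stays inside
      \<open>{a..b}\<close>, whichever side \<open>y\<close> lies on.\<close>
    define r where "r = min d (min (x - a) (b - x))"
    have "norm (?F y - ?F x - (y - x) *\<^sub>R f x) \<le> e * norm (y - x)" if y: "norm (y - x) < r" for y
    proof -
      consider "y = x" | "y < x" | "x < y" by linarith
      then show ?thesis
      proof cases
        case 1 then show ?thesis by simp
      next
        case 2
        have "norm ((x - y) *\<^sub>R f x - integral {y..x} f) < inverse (Suc n) * (x - y)"
          by (rule nb) (use 2 y x in \<open>auto simp: r_def\<close>)
        also have "\<dots> \<le> e * (x - y)" using n 2 by (intro mult_right_mono) auto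
        also have "integral {y..x} f = ?F x - ?F y"
          by (rule comb[symmetric]) (use 2 y x in \<open>auto simp: r_def\<close>)
        finally have "norm ((x - y) *\<^sub>R f x - (?F x - ?F y)) < e * (x - y)" .
        moreover have "(x - y) *\<^sub>R f x - (?F x - ?F y) = ?F y - ?F x - (y - x) *\<^sub>R f x"
          by (simp add: algebra_simps)
        ultimately show ?thesis using 2 by simp
      next
        case 3
        have "norm ((y - x) *\<^sub>R f x - integral {x..y} f) < inverse (Suc n) * (y - x)"
          by (rule nb) (use 3 y x in \<open>auto simp: r_def\<close>)
        also have "\<dots> \<le> e * (y - x)" using n 3 by (intro mult_right_mono) auto
        also have "integral {x..y} f = ?F y - ?F x"
          by (rule comb[symmetric]) (use 3 y x in \<open>auto simp: r_def\<close>)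
        finally show ?thesis using 3 by (simp add: norm_minus_commute)
      qed
    qed
    moreover have "r > 0" using d x by (simp add: r_def)
    ultimately show "\<exists>d>0. \<forall>y\<in>UNIV. norm (y - x) < d \<longrightarrow> norm (?F y - ?F x - (y - x) *\<^sub>R f x) \<le> e * norm (y - x)"
      by blast
  qed
qed

section \<open>Continuous functions with vanishing moments\<close>

text \<open>By linearity \<open>h\<close> is orthogonal to every polynomial \<open>q\<close>, so the
  integral of \<open>h t * h t\<close> equals that of \<open>h t * (h t - q t)\<close>. By
  Weierstrass approximation the latter can be made arbitrarily small. Hence the square of
  \<open>h\<close> has integral 0, and continuity makes it vanish at every point.\<close>

lemma continuous_eq_0_if_moments_eq_0:
  fixes h :: "real \<Rightarrow> real"
  assumes "continuous_on {a..b} h" "a < b"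
    and mom: "\<And>n. integral {a..b} (\<lambda>t. h t * t ^ n) = 0"
    and "x \<in> {a..b}"
  shows "h x = 0"
proof -
  have pol: "integral {a..b} (\<lambda>t. h t * q t) = 0" if q: "real_polynomial_function q" for q
  proof -
    obtain c n where qs: "q = (\<lambda>x. \<Sum>i\<le>n. c i * x ^ i)"
      using q unfolding real_polynomial_function_iff_sum by blast
    have "((\<lambda>t. \<Sum>i\<le>n. c i * (h t * t ^ i)) has_integral (\<Sum>i\<le>n. c i * 0)) {a..b}"
    proof (intro has_integral_sum has_integral_mult_right)
      fix i
      have "(\<lambda>t. h t * t ^ i) integrable_on {a..b}"
        by (intro integrable_continuous_real continuous_intros assms(1))
      then show "((\<lambda>t. h t * t ^ i) has_integral 0) {a..b}"
        using integrable_integral[of "\<lambda>t. h t * t ^ i" "{a..b}"] by (simp only: mom)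
    qed simp
    moreover have "(\<Sum>i\<le>n. c i * (h t * t ^ i)) = h t * q t" for t
      by (simp add: qs sum_distrib_left mult_ac)
    ultimately show ?thesis by (simp add: integral_unique)
  qed
  obtain B where B: "\<And>x. x \<in> {a..b} \<Longrightarrow> \<bar>h x\<bar> \<le> B"
    using compact_imp_bounded[OF compact_continuous_image[OF assms(1) compact_Icc]]
    by (auto simp: bounded_iff simp del: atLeastAtMost_iff)
  have sq: "continuous_on {a..b} (\<lambda>t. h t * h t)" by (intro continuous_intros assms(1))
  have "integral {a..b} (\<lambda>t. h t * h t) \<le> 0 + e" if "e > 0" for e
  proof -
    \<comment> \<open>Chosen so that the error bound, the integral of the constant
      \<open>(\<bar>B\<bar> + 1) * d\<close>, is exactly \<open>e\<close>; the summand 1 keeps the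
      denominator positive.\<close>
    define d where "d = e / ((\<bar>B\<bar> + 1) * (b - a))"
    have "d > 0" using that \<open>a < b\<close> by (simp add: d_def)
    then obtain q where q: "real_polynomial_function q" "\<And>x. x \<in> {a..b} \<Longrightarrow> \<bar>h x - q x\<bar> < d"
      using Stone_Weierstrass_real_polynomial_function[of "{a..b}" h d] assms by auto
    have cq: "continuous_on {a..b} q" using q(1) by (simp add: continuous_on_polymonial_function real_polynomial_function_eq)
    have "integral {a..b} (\<lambda>t. h t * h t) = integral {a..b} (\<lambda>t. h t * h t) - integral {a..b} (\<lambda>t. h t * q t)"
      using pol q by simp
    also have "\<dots> = integral {a..b} (\<lambda>t. h t * (h t - q t))"
      unfolding right_diff_distrib
      by (rule integral_diff[symmetric]) (intro integrable_continuous_real continuous_intros assms(1) cq)+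
    also have "\<dots> \<le> integral {a..b} (\<lambda>t. (\<bar>B\<bar> + 1) * d)"
    proof (rule integral_le)
      fix t assume t: "t \<in> {a..b}"
      have "h t * (h t - q t) \<le> \<bar>h t\<bar> * \<bar>h t - q t\<bar>" by (metis abs_ge_self abs_mult)
      also have "\<dots> \<le> (\<bar>B\<bar> + 1) * d" using B[OF t] q(2)[OF t] by (intro mult_mono) auto
      finally show "h t * (h t - q t) \<le> (\<bar>B\<bar> + 1) * d" .
    qed (intro integrable_continuous_real continuous_intros assms(1) cq)+
    also have "\<dots> = e" using \<open>a < b\<close> by (simp add: d_def)
    finally show ?thesis by simp
  qed
  then have "integral {a..b} (\<lambda>t. h t * h t) \<le> 0" by (rule field_le_epsilon)
  moreover have "integral {a..b} (\<lambda>t. h t * h t) \<ge> 0" by (intro integral_nonneg integrable_continuous_real sq) auto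
  ultimately have "integral {a..b} (\<lambda>t. h t * h t) = 0" by simp
  then have "((\<lambda>t. h t * h t) has_integral 0) (cbox a b)"
    using integrable_integral[OF integrable_continuous_real[OF sq]] by (simp add: box_real)
  then have "h x * h x = 0"
    using has_integral_0_cbox_imp_0[of a b "\<lambda>t. h t * h t" x] sq assms(2,4) by (simp add: box_real)
  then show ?thesis by simp
qed

subsection \<open>Fubini's theorem for convolutions\<close>

lemma borel_measurable_lebesgue_ident [measurable]: "(\<lambda>x::real. x) \<in> borel_measurable lebesgue"
  by (intro measurable_completion) simp

text \<open>Makes Fubini's theorem available for the product of two copies of
  \<open>lebesgue\<close>.\<close>

lemma sigma_finite_lebesgue: "sigma_finite_measure (lebesgue :: real measure)"
proof
  have "\<Union>(range (\<lambda>n. {- real n..real n})) = UNIV"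
  proof -
    have "\<exists>n. x \<in> {- real n..real n}" for x
      using real_arch_simple[of "\<bar>x\<bar>"] by (auto simp: abs_le_iff minus_le_iff)
    then show ?thesis by blast
  qed
  then show "\<exists>A. countable A \<and> A \<subseteq> sets lebesgue \<and> \<Union>A = space lebesgue \<and>
      (\<forall>a\<in>A. emeasure (lebesgue :: real measure) a \<noteq> \<infinity>)"
    by (intro exI[of _ "range (\<lambda>n. {- real n..real n})"]) auto
qed

text \<open>Moves a Borel kernel to \<open>lborel\<close>, where the affine substitution rules
  apply.\<close>

lemma set_integrable_lborel_lebesgue_iff:
  fixes k :: "real \<Rightarrow> real"
  assumes "k \<in> borel_measurable borel"
  shows "set_integrable lebesgue {a..b} k \<longleftrightarrow> integrable lborel (\<lambda>x. indicator {a..b} x * k x)"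
  unfolding set_integrable_def using assms by (simp add: integrable_completion)

text \<open>Fubini's theorem on the triangle 0 \<le> s \<le> t \<le> T. The integrand is dominated
  by a constant times \<open>\<bar>a t\<bar> * \<bar>k (t - s)\<bar>\<close>, whose iterated
  integral is finite. The kernel is Borel so that its composition with \<open>t - s\<close> is
  measurable on the product. With a power kernel this is fractional integration by parts; with the
  kernel 1 it is ordinary integration by parts for an indefinite integral.\<close>

lemma integral_convolution_swap:
  fixes a b k :: "real \<Rightarrow> real"
  assumes a: "set_integrable lebesgue {0..T} a"
    and b: "set_borel_measurable lebesgue {0..T} b" "\<And>s. s \<in> {0..T} \<Longrightarrow> \<bar>b s\<bar> \<le> B"
    and k: "k \<in> borel_measurable borel" "set_integrable lebesgue {0..T} k"
  shows "(LINT t:{0..T}|lebesgue. a t * (LINT s:{0..t}|lebesgue. k (t - s) * b s)) =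
    (LINT s:{0..T}|lebesgue. b s * (LINT t:{s..T}|lebesgue. k (t - s) * a t))"
proof -
  interpret L: sigma_finite_measure "lebesgue :: real measure" by (rule sigma_finite_lebesgue)
  interpret P: pair_sigma_finite "lebesgue :: real measure" "lebesgue :: real measure" ..
  \<comment> \<open>Extension by 0 encodes the triangle: \<open>h t s\<close> can be nonzero only if
    0 \<le> s \<le> t \<le> T.\<close>
  define a' where "a' t = indicator {0..T} t * a t" for t
  define b' where "b' s = indicator {0..T} s * b s" for s
  define k' where "k' x = indicator {0..T} x * k x" for x
  define h where "h t s = a' t * (k' (t - s) * b' s)" for t s
  have a': "integrable lebesgue a'" using a unfolding set_integrable_def a'_def by simp
  have b'm [measurable]: "b' \<in> borel_measurable lebesgue"
    using b(1) unfolding set_borel_measurable_def b'_def by simp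
  have a'm [measurable]: "a' \<in> borel_measurable lebesgue" using a' by auto
  have k'm [measurable]: "k' \<in> borel_measurable borel" using k(1) unfolding k'_def by measurable
  have k': "integrable lborel k'"
    using k(2) unfolding set_integrable_lborel_lebesgue_iff[OF k(1)] k'_def .
  have fs [measurable]: "fst \<in> borel_measurable (lebesgue \<Otimes>\<^sub>M (lebesgue :: real measure) :: (real \<times> real) measure)"
    "snd \<in> borel_measurable ((lebesgue :: real measure) \<Otimes>\<^sub>M lebesgue :: (real \<times> real) measure)"
    using measurable_compose[OF measurable_fst borel_measurable_lebesgue_ident] measurable_compose[OF measurable_snd borel_measurable_lebesgue_ident] by auto
  have hm [measurable]: "case_prod h \<in> borel_measurable (lebesgue \<Otimes>\<^sub>M lebesgue)"
    unfolding h_def by measurable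
  have kt: "integrable lebesgue (\<lambda>s. k' (t - s))" for t
    using lborel_integrable_real_affine[OF k', of "-1" t] by (simp add: integrable_completion)
  \<comment> \<open>Reflection and translation leave the integral unchanged, so the bound on the
    inner integral does not depend on \<open>t\<close>.\<close>
  have kt_eq: "(\<integral>s. \<bar>k' (t - s)\<bar> \<partial>lebesgue) = (\<integral>x. \<bar>k' x\<bar> \<partial>lborel)" for t
    using lborel_integral_real_affine[of "-1" "\<lambda>x. \<bar>k' x\<bar>" t] by (simp add: integral_completion)
  \<comment> \<open>The sign of \<open>B\<close> is unknown if \<open>{0..T}\<close> is empty; the
    absolute value is a nonnegative bound in every case.\<close>
  define B' where "B' = \<bar>B\<bar>"
  have bB: "\<bar>b' s\<bar> \<le> B'" for s
    using b(2)[of s] by (auto simp: b'_def B'_def indicator_def)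
  have hB: "\<bar>h t s\<bar> \<le> \<bar>a' t\<bar> * B' * \<bar>k' (t - s)\<bar>" for t s
    using mult_left_mono[OF bB[of s], of "\<bar>a' t\<bar> * \<bar>k' (t - s)\<bar>"] by (simp add: h_def abs_mult mult_ac)
  have ht: "integrable lebesgue (h t)" for t
  proof (rule Bochner_Integration.integrable_bound)
    show "integrable lebesgue (\<lambda>s. \<bar>a' t\<bar> * B' * \<bar>k' (t - s)\<bar>)"
      using kt[of t] by auto
    show "h t \<in> borel_measurable lebesgue"
      unfolding h_def using kt[of t] by measurable
    show "AE s in lebesgue. norm (h t s) \<le> norm (\<bar>a' t\<bar> * B' * \<bar>k' (t - s)\<bar>)"
      using hB by (auto simp: B'_def abs_mult)
  qed
  have "integrable (lebesgue \<Otimes>\<^sub>M lebesgue) (case_prod h)"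
  proof (rule P.Fubini_integrable[OF hm])
    show "integrable lebesgue (\<lambda>t. \<integral>s. norm (case_prod h (t, s)) \<partial>lebesgue)"
    proof (rule Bochner_Integration.integrable_bound)
      show "integrable lebesgue (\<lambda>t. \<bar>a' t\<bar> * B' * (\<integral>x. \<bar>k' x\<bar> \<partial>lborel))"
        using a' by auto
      show "(\<lambda>t. \<integral>s. norm (case_prod h (t, s)) \<partial>lebesgue) \<in> borel_measurable lebesgue"
        by measurable
      have "(\<integral>s. norm (h t s) \<partial>lebesgue) \<le> (\<integral>s. \<bar>a' t\<bar> * B' * \<bar>k' (t - s)\<bar> \<partial>lebesgue)" for t
        using ht[of t] kt[of t] hB by (intro integral_mono) auto
      then show "AE t in lebesgue. norm (\<integral>s. norm (case_prod h (t, s)) \<partial>lebesgue) \<le>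
          norm (\<bar>a' t\<bar> * B' * (\<integral>x. \<bar>k' x\<bar> \<partial>lborel))"
        by (auto simp: kt_eq abs_mult B'_def)
    qed
    show "AE t in lebesgue. integrable lebesgue (\<lambda>s. case_prod h (t, s))" using ht by simp
  qed
  then have "(\<integral>s. (\<integral>t. h t s \<partial>lebesgue) \<partial>lebesgue) = (\<integral>t. (\<integral>s. h t s \<partial>lebesgue) \<partial>lebesgue)"
    by (rule P.Fubini_integral)
  moreover have "(\<integral>s. h t s \<partial>lebesgue) =
      indicator {0..T} t *\<^sub>R (a t * (LINT s:{0..t}|lebesgue. k (t - s) * b s))" for t
  proof -
    have "h t s = indicator {0..T} t * a t * (indicator {0..t} s *\<^sub>R (k (t - s) * b s))" for s
      by (auto simp: h_def a'_def b'_def k'_def indicator_def)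
    then show ?thesis by (simp add: set_lebesgue_integral_def)
  qed
  moreover have "(\<integral>t. h t s \<partial>lebesgue) =
      indicator {0..T} s *\<^sub>R (b s * (LINT t:{s..T}|lebesgue. k (t - s) * a t))" for s
  proof -
    have "h t s = indicator {0..T} s * b s * (indicator {s..T} t *\<^sub>R (k (t - s) * a t))" for t
      by (auto simp: h_def a'_def b'_def k'_def indicator_def)
    then show ?thesis by (simp add: set_lebesgue_integral_def)
  qed
  ultimately show ?thesis by (simp add: set_lebesgue_integral_def)
qed

subsection \<open>A fundamental lemma for polynomial test functions\<close>

text \<open>The identity \<open>weak\<close> says that \<open>J' = - g\<close> holds when tested
  with polynomials vanishing at both ends. Absorbing the weight \<open>t * (T - t)\<close> into
  \<open>K\<close> and \<open>k\<close> turns it into \<open>K' = k\<close> tested with all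
  monomials, which determines \<open>K\<close>. Integrability is assumed for the weighted
  \<open>g\<close> only, as \<open>g\<close> may behave badly at the end points. These form a null
  set, so the derivative can be two-sided.\<close>

lemma AE_has_real_derivative_if_moments:
  fixes J g :: "real \<Rightarrow> real"
  assumes "0 < T" and J: "continuous_on {0..T} J"
    and g: "set_integrable lebesgue {0..T} (\<lambda>t. g t * (t * (T - t)))"
    and weak: "\<And>n. (LINT t:{0..T}|lebesgue. J t * ((T - 2 * t) * t ^ n + t * (T - t) * (real n * t ^ (n - 1)))) =
      (LINT t:{0..T}|lebesgue. g t * (t * (T - t) * t ^ n))"
  shows "AE t in lebesgue. t \<in> {0..T} \<longrightarrow> t \<in> {0<..<T} \<and> (J has_real_derivative - g t) (at t)"
proof -
  define h where "h t = g t * (t * (T - t))" for t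
  define K where "K t = J t * (t * (T - t))" for t
  define k where "k t = J t * (T - 2 * t) - h t" for t
  define M where "M t = (LINT s:{0..t}|lebesgue. k s)" for t
  have h: "set_integrable lebesgue {0..T} h" using g by (simp add: h_def[abs_def])
  have contK: "continuous_on {0..T} K" unfolding K_def by (intro continuous_intros J)
  have k: "set_integrable lebesgue {0..T} k"
    unfolding k_def[abs_def]
    by (intro set_integral_diff absolutely_integrable_continuous_real continuous_intros J h)
  have k_sub: "set_integrable lebesgue {a..b} k" if "0 \<le> a" "b \<le> T" for a b
    by (rule set_integrable_subset[OF k]) (use that in auto)
  have M_eq: "M t = integral {0..t} k" if "t \<le> T" for t
    unfolding M_def using set_lebesgue_integral_eq_integral(2)[OF k_sub[OF order_refl that]] .
  have k_hk: "k integrable_on {0..T}"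
    using set_lebesgue_integral_eq_integral(1)[OF k] .
  have contM: "continuous_on {0..T} M"
    using indefinite_integral_continuous_1[OF k_hk] by (rule continuous_on_eq) (simp add: M_eq)
  have h_pow: "set_integrable lebesgue {0..T} (\<lambda>t. h t * t ^ n)" for n
  proof (rule set_integrable_bound)
    show "set_integrable lebesgue {0..T} (\<lambda>t. T ^ n * h t)" using h by simp
    have "(\<lambda>t. indicator {0..T} t *\<^sub>R h t) \<in> borel_measurable lebesgue"
      using h unfolding set_integrable_def by (rule borel_measurable_integrable)
    moreover have "(\<lambda>t::real. t ^ n) \<in> borel_measurable lebesgue"
      by (intro measurable_completion) simp
    ultimately have "(\<lambda>t. (indicator {0..T} t *\<^sub>R h t) * t ^ n) \<in> borel_measurable lebesgue"
      by (rule borel_measurable_times)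
    then show "set_borel_measurable lebesgue {0..T} (\<lambda>t. h t * t ^ n)"
      by (simp add: set_borel_measurable_def mult.assoc)
    show "AE t in lebesgue. t \<in> {0..T} \<longrightarrow> norm (h t * t ^ n) \<le> norm (T ^ n * h t)"
    proof (intro AE_I2 impI)
      fix t assume "t \<in> {0..T}"
      then have "\<bar>h t\<bar> * t ^ n \<le> \<bar>h t\<bar> * T ^ n" by (intro mult_left_mono power_mono) auto
      then show "norm (h t * t ^ n) \<le> norm (T ^ n * h t)"
        using \<open>t \<in> {0..T}\<close> \<open>0 < T\<close> by (simp add: abs_mult power_abs mult.commute)
    qed
  qed
  \<comment> \<open>The weak form of \<open>K' = k\<close>. There are no boundary terms, because
    \<open>K\<close> vanishes at \<open>0\<close> and \<open>T\<close>.\<close>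
  have weak': "(LINT t:{0..T}|lebesgue. k t * t ^ n) = - (LINT t:{0..T}|lebesgue. K t * (real n * t ^ (n - 1)))" for n
  proof -
    have "(LINT t:{0..T}|lebesgue. J t * ((T - 2 * t) * t ^ n + t * (T - t) * (real n * t ^ (n - 1)))) =
        (LINT t:{0..T}|lebesgue. J t * (T - 2 * t) * t ^ n + K t * (real n * t ^ (n - 1)))"
      by (simp add: K_def algebra_simps)
    also have "\<dots> = (LINT t:{0..T}|lebesgue. J t * (T - 2 * t) * t ^ n) +
        (LINT t:{0..T}|lebesgue. K t * (real n * t ^ (n - 1)))"
      by (intro set_integral_add absolutely_integrable_continuous_real continuous_intros J contK)
    finally have 1: "(LINT t:{0..T}|lebesgue. J t * (T - 2 * t) * t ^ n) +
        (LINT t:{0..T}|lebesgue. K t * (real n * t ^ (n - 1))) = (LINT t:{0..T}|lebesgue. h t * t ^ n)"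
      using weak[of n] by (simp add: h_def mult.assoc)
    have "(LINT t:{0..T}|lebesgue. k t * t ^ n) =
        (LINT t:{0..T}|lebesgue. J t * (T - 2 * t) * t ^ n - h t * t ^ n)"
      by (simp add: k_def left_diff_distrib)
    also have "\<dots> = (LINT t:{0..T}|lebesgue. J t * (T - 2 * t) * t ^ n) - (LINT t:{0..T}|lebesgue. h t * t ^ n)"
      by (intro set_integral_diff absolutely_integrable_continuous_real continuous_intros J h_pow)
    finally show ?thesis using 1 by simp
  qed
  \<comment> \<open>For \<open>n = 0\<close> the factor \<open>real n\<close> annihilates the
    right-hand side, so \<open>k\<close> has integral 0 over \<open>{0..T}\<close>.\<close>
  have MT: "M T = 0" using weak'[of 0] by (simp add: M_def)
  have tail: "(LINT t:{s..T}|lebesgue. k t) = - M s" if "s \<in> {0..T}" for s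
  proof -
    have "integral {0..s} k + integral {s..T} k = integral {0..T} k"
      using that k_hk by (intro Henstock_Kurzweil_Integration.integral_combine) auto
    moreover have "(LINT t:{s..T}|lebesgue. k t) = integral {s..T} k"
      using set_lebesgue_integral_eq_integral(2)[OF k_sub] that by auto
    ultimately show ?thesis using MT that M_eq[of s] M_eq[of T] by simp
  qed
  \<comment> \<open>Integration by parts without differentiating \<open>M\<close>: the power
    \<open>t ^ Suc n\<close> is written as the integral of its derivative, and exchanging the
    integrals turns the moment of \<open>k\<close> into minus the integral of
    \<open>M s * ?b s\<close>. Comparison with \<open>weak'\<close> shows that \<open>K\<close> and
    \<open>M\<close> have equal moments.\<close>
  have mom: "integral {0..T} (\<lambda>t. (K t - M t) * t ^ n) = 0" for n
  proof -
    let ?b = "\<lambda>s. real (Suc n) * s ^ n"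
    have cb: "continuous_on A ?b" for A by (intro continuous_intros)
    \<comment> \<open>The factor \<open>1\<close> is the constant kernel in the instance of
      \<open>integral_convolution_swap\<close> below.\<close>
    have prim: "(LINT s:{0..t}|lebesgue. 1 * ?b s) = t ^ Suc n" if "t \<in> {0..T}" for t
    proof -
      have "(?b has_integral t ^ Suc n - 0 ^ Suc n) {0..t}"
      proof (rule fundamental_theorem_of_calculus)
        fix x
        show "((\<lambda>t. t ^ Suc n) has_vector_derivative ?b x) (at x within {0..t})"
          using DERIV_pow[of "Suc n" x "{0..t}"]
          by (simp add: has_real_derivative_iff_has_vector_derivative del: power_Suc of_nat_Suc)
      qed (use that in simp)
      from integral_unique[OF this] have "integral {0..t} ?b = t ^ Suc n" by (simp only: power_0_Suc diff_zero)
      then show ?thesis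
        unfolding mult_1 set_lebesgue_integral_eq_integral(2)[OF absolutely_integrable_continuous_real[OF cb, of 0 t]] .
    qed
    have "(LINT t:{0..T}|lebesgue. k t * t ^ Suc n) =
        (LINT t:{0..T}|lebesgue. k t * (LINT s:{0..t}|lebesgue. 1 * ?b s))"
      by (rule set_lebesgue_integral_cong) (simp, intro allI impI, subst prim, assumption, rule refl)
    also have "\<dots> = (LINT s:{0..T}|lebesgue. ?b s * (LINT t:{s..T}|lebesgue. 1 * k t))"
    proof (rule integral_convolution_swap[where k = "\<lambda>_. 1" and B = "real (Suc n) * T ^ n"])
      show "set_borel_measurable lebesgue {0..T} ?b"
        using absolutely_integrable_continuous_real[OF cb, of 0 T]
        unfolding set_borel_measurable_def set_integrable_def by (rule borel_measurable_integrable)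
      show "\<bar>real (Suc n) * s ^ n\<bar> \<le> real (Suc n) * T ^ n" if "s \<in> {0..T}" for s
        using that by (simp add: abs_mult power_abs mult_left_mono power_mono del: of_nat_Suc)
      show "set_integrable lebesgue {0..T} (\<lambda>_. 1::real)"
        by (intro absolutely_integrable_continuous_real continuous_intros)
    qed (simp_all add: k)
    also have "\<dots> = (LINT s:{0..T}|lebesgue. - (M s * ?b s))"
      by (rule set_lebesgue_integral_cong) (simp_all add: tail del: of_nat_Suc)
    finally have "(LINT s:{0..T}|lebesgue. - (M s * ?b s)) = - (LINT s:{0..T}|lebesgue. K s * ?b s)"
      using weak'[of "Suc n"] by simp
    then have "(LINT s:{0..T}|lebesgue. K s * ?b s) - (LINT s:{0..T}|lebesgue. M s * ?b s) = 0"
      by (simp add: set_lebesgue_integral_def)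
    moreover have "(LINT s:{0..T}|lebesgue. K s * ?b s) - (LINT s:{0..T}|lebesgue. M s * ?b s) =
        (LINT s:{0..T}|lebesgue. K s * ?b s - M s * ?b s)"
      by (intro set_integral_diff(2)[symmetric] absolutely_integrable_continuous_real continuous_intros contK contM)
    moreover have "(LINT s:{0..T}|lebesgue. K s * ?b s - M s * ?b s) =
        real (Suc n) * (LINT s:{0..T}|lebesgue. (K s - M s) * s ^ n)"
      by (subst set_integral_mult_right[symmetric]) (simp add: algebra_simps)
    ultimately have "(LINT s:{0..T}|lebesgue. (K s - M s) * s ^ n) = 0" by simp
    moreover have "set_integrable lebesgue {0..T} (\<lambda>s. (K s - M s) * s ^ n)"
      by (intro absolutely_integrable_continuous_real continuous_intros contK contM)
    ultimately show ?thesis using set_lebesgue_integral_eq_integral(2) by metis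
  qed
  have KM: "K t = M t" if "t \<in> {0..T}" for t
    using continuous_eq_0_if_moments_eq_0[of 0 T "\<lambda>t. K t - M t" t] mom contK contM \<open>0 < T\<close> that
    by (simp add: continuous_on_diff)
  obtain N where N: "negligible N" and der: "\<And>t. t \<in> {0<..<T} - N \<Longrightarrow>
      ((\<lambda>y. integral {0..y} k) has_vector_derivative k t) (at t)"
    using lebesgue_differentiation[OF k_hk] by metis
  have "(J has_real_derivative - g t) (at t)" if t: "t \<in> {0<..<T} - N" for t
  proof -
    have pos: "t * (T - t) \<noteq> 0" using t by simp
    \<comment> \<open>On the open interval \<open>J\<close> is this quotient. In the quotient rule
      the two terms containing \<open>J t\<close> cancel and \<open>- g t\<close> remains.\<close>
    have "((\<lambda>y. integral {0..y} k / (y * (T - y))) has_real_derivative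
        (k t * (t * (T - t)) - integral {0..t} k * (T - 2 * t)) / (t * (T - t) * (t * (T - t)))) (at t)"
      using der[OF t, folded has_real_derivative_iff_has_vector_derivative] pos
      by (intro DERIV_divide) (auto intro!: derivative_eq_intros)
    moreover have int_k: "integral {0..t} k = J t * (t * (T - t))"
      using KM[of t] M_eq[of t] t by (simp add: K_def)
    have "k t * (t * (T - t)) - integral {0..t} k * (T - 2 * t) = - g t * (t * (T - t) * (t * (T - t)))"
      unfolding int_k by (simp add: k_def h_def algebra_simps)
    then have "(k t * (t * (T - t)) - integral {0..t} k * (T - 2 * t)) / (t * (T - t) * (t * (T - t))) = - g t"
      using pos by simp
    ultimately have "((\<lambda>y. integral {0..y} k / (y * (T - y))) has_real_derivative - g t) (at t)" by simp
    then show ?thesis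
    proof (rule has_field_derivative_transform_within_open)
      show "open {0<..<T}" "t \<in> {0<..<T}" using t by auto
      show "integral {0..y} k / (y * (T - y)) = J y" if "y \<in> {0<..<T}" for y
      proof -
        have "integral {0..y} k = J y * (y * (T - y))"
          using KM[of y] M_eq[of y] that by (simp add: K_def)
        then show ?thesis using that by simp
      qed
    qed
  qed
  moreover have "N \<union> {0, T} \<in> null_sets lebesgue"
    using N by (simp add: negligible_iff_null_sets[symmetric])
  ultimately show ?thesis
    by (intro AE_I'[of "N \<union> {0, T}"]) (auto simp: less_le)
qed

subsection \<open>Fractional derivatives of polynomials\<close>

text \<open>The substitution \<open>s = t * x\<close> reduces the integral to Euler's beta integral
  over the unit interval.\<close>

lemma has_integral_beta_kernel:
  fixes t c :: real
  assumes "0 < t" "0 < c"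
  shows "((\<lambda>s. (t - s) powr (c - 1) * s ^ n) has_integral
    t powr (real n + c) * Beta (real n + 1) c) {0..t}"
proof -
  have "((\<lambda>x. x powr (real n + 1 - 1) * (1 - x) powr (c - 1)) has_integral Beta (real n + 1) c) (cbox 0 1)"
    using has_integral_Beta_real[of "real n + 1" c] assms by simp
  from has_integral_affinity[OF this, of "1 / t" 0] assms
  have 1: "((\<lambda>s. (s / t) powr real n * (1 - s / t) powr (c - 1)) has_integral t * Beta (real n + 1) c) {0..t}"
    by (simp add: image_mult_atLeastAtMost)
  have "((\<lambda>s. t powr (real n + c - 1) * ((s / t) powr real n * (1 - s / t) powr (c - 1)))
      has_integral t powr (real n + c - 1) * (t * Beta (real n + 1) c)) {0..t}"
    by (rule has_integral_mult_right[OF 1])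
  also have "t powr (real n + c - 1) * (t * Beta (real n + 1) c) = t powr (real n + c) * Beta (real n + 1) c"
    using assms by (simp add: powr_diff)
  \<comment> \<open>The point \<open>s = 0\<close> is exempted since \<open>0 powr 0\<close> is 0
    whereas \<open>0 ^ 0\<close> is 1.\<close>
  finally show ?thesis
  proof (rule has_integral_spike_finite[rotated 2])
    show "finite {0 :: real}" by simp
    fix s assume s: "s \<in> {0..t} - {0}"
    then have "(1 - s / t) powr (c - 1) = (t - s) powr (c - 1) / t powr (c - 1)"
      using assms by (subst powr_divide[symmetric]) (auto simp: field_simps)
    moreover have "(s / t) powr real n = s ^ n / t powr real n"
      using s assms by (simp add: powr_divide powr_realpow)
    moreover have "t powr (real n + c - 1) = t powr real n * t powr (c - 1)"
      using powr_add[of t "real n" "c - 1"] by (simp add: add_diff_eq)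
    ultimately show "(t - s) powr (c - 1) * s ^ n =
        t powr (real n + c - 1) * ((s / t) powr real n * (1 - s / t) powr (c - 1))"
      using assms by simp
  qed
qed

lemma set_integrable_rl_kernel_monomial:
  fixes t c :: real
  assumes "0 < c"
  shows "set_integrable lebesgue {0..t} (\<lambda>s. (t - s) powr (c - 1) * s ^ n)"
proof (cases "0 < t")
  case True
  then show ?thesis
    using has_integral_beta_kernel[OF True assms, of n]
    by (intro nonnegative_absolutely_integrable_1) (auto simp: has_integral_integrable)
next
  case False
  then have "{0..t} \<in> null_sets lebesgue" by (cases "t = 0") (auto simp: null_sets_completionI)
  moreover have "(\<lambda>s. indicator {0..t} s *\<^sub>R ((t - s) powr (c - 1) * s ^ n)) \<in> borel_measurable lebesgue"
    by (intro measurable_completion) simp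
  ultimately show ?thesis unfolding set_integrable_def
    by (intro integrable_cong_AE_imp[OF integrable_zero] AE_I'[of "{0..t}"]) (auto simp: indicator_def)
qed

text \<open>The power rule of fractional integration: dividing the beta integral by
  \<open>Gamma c\<close> leaves the quotient of Gamma values. At \<open>t = 0\<close> both sides are
  0.\<close>

lemma rl_left_int_monomial:
  assumes "0 < c" "0 \<le> t"
  shows "rl_left_int c (\<lambda>s. s ^ n) t = Gamma (real n + 1) / Gamma (real n + 1 + c) * t powr (real n + c)"
proof (cases "t = 0")
  case True
  have "(LINT s:{0..0}|lebesgue. (0 - s) powr (c - 1) * s ^ n) = (0::real)"
    unfolding set_lebesgue_integral_def
    by (rule integral_eq_zero_AE, rule AE_I'[of "{0}"]) (auto simp: indicator_def null_sets_completionI)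
  then show ?thesis using True by (simp add: rl_left_int_def)
next
  case False
  then have t: "0 < t" using assms by simp
  have "Gamma c > 0" using assms by (simp add: Gamma_real_pos)
  moreover have "(LINT s:{0..t}|lebesgue. (t - s) powr (c - 1) * s ^ n) = t powr (real n + c) * Beta (real n + 1) c"
    using set_lebesgue_integral_eq_integral(2)[OF set_integrable_rl_kernel_monomial[OF assms(1)]]
      has_integral_beta_kernel[OF t assms(1)] by (metis integral_unique)
  ultimately show ?thesis by (simp add: rl_left_int_def Beta_def)
qed

text \<open>A free upper limit allows a polynomial and its derivative to be summed over matching
  index ranges.\<close>

lemma poly_eq_sum_le:
  fixes P :: "'a::comm_semiring_1 poly"
  assumes "degree P \<le> n"
  shows "poly P x = (\<Sum>i\<le>n. coeff P i * x ^ i)"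
  unfolding poly_altdef using assms by (intro sum.mono_neutral_left) (auto simp: coeff_eq_0)

lemma set_integrable_rl_kernel_poly:
  fixes t c :: real
  assumes "0 < c"
  shows "set_integrable lebesgue {0..t} (\<lambda>s. (t - s) powr (c - 1) * poly P s)"
proof -
  have "set_integrable lebesgue {0..t} (\<lambda>s. \<Sum>i\<le>degree P. coeff P i * ((t - s) powr (c - 1) * s ^ i))"
    unfolding set_integrable_def scaleR_sum_right
    using set_integrable_mult_right[OF set_integrable_rl_kernel_monomial[OF assms, of t]]
    by (intro Bochner_Integration.integrable_sum) (simp add: set_integrable_def)
  then show ?thesis by (simp add: poly_altdef sum_distrib_left mult_ac)
qed

lemma rl_left_int_poly:
  assumes "0 < c" "0 \<le> t" "degree P \<le> n"
  shows "rl_left_int c (poly P) t =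
    (\<Sum>i\<le>n. coeff P i * (Gamma (real i + 1) / Gamma (real i + 1 + c)) * t powr (real i + c))"
proof -
  let ?k = "\<lambda>i s. (t - s) powr (c - 1) * s ^ i"
  have "(LINT s:{0..t}|lebesgue. (t - s) powr (c - 1) * poly P s) =
      (LINT s:{0..t}|lebesgue. \<Sum>i\<le>n. coeff P i * ?k i s)"
    by (simp add: poly_eq_sum_le[OF assms(3)] sum_distrib_left mult_ac)
  also have "\<dots> = (\<Sum>i\<le>n. LINT s:{0..t}|lebesgue. coeff P i * ?k i s)"
    unfolding set_lebesgue_integral_def scaleR_sum_right
    using set_integrable_mult_right[OF set_integrable_rl_kernel_monomial[OF assms(1), of t]]
    by (intro Bochner_Integration.integral_sum) (simp add: set_integrable_def)
  also have "\<dots> = (\<Sum>i\<le>n. coeff P i * (LINT s:{0..t}|lebesgue. ?k i s))"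
    by (simp add: set_integral_mult_right)
  finally have "rl_left_int c (poly P) t = (\<Sum>i\<le>n. coeff P i * rl_left_int c (\<lambda>s. s ^ i) t)"
    by (simp add: rl_left_int_def sum_distrib_left mult_ac)
  then show ?thesis using assms by (simp add: rl_left_int_monomial mult_ac)
qed

text \<open>For \<open>P\<close> vanishing at 0, differentiation commutes with fractional
  integration, so the Riemann-Liouville derivative takes its Caputo form. The proof is termwise by
  the functional equation of Gamma; the condition at 0 removes the power \<open>t powr c\<close>,
  which has no counterpart on the right.\<close>

lemma has_real_derivative_rl_left_int_poly:
  assumes "0 < c" "0 < t" "poly P 0 = 0"
  shows "(rl_left_int c (poly P) has_real_derivative rl_left_int c (poly (pderiv P)) t) (at t)"
proof -
  \<comment> \<open>The sum for \<open>P\<close> will run to \<open>Suc n\<close>, one beyond the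
    degree. Without its constant term it then has the same index range as the sum for
    \<open>pderiv P\<close>, also for constant \<open>P\<close>.\<close>
  define n where "n = degree P"
  have c0: "coeff P 0 = 0" using assms by (simp add: poly_0_coeff_0)
  let ?a = "\<lambda>i. coeff P (Suc i) * (Gamma (real (Suc i) + 1) / Gamma (real (Suc i) + 1 + c))"
  have dg: "degree P \<le> Suc n" "degree (pderiv P) \<le> n"
    by (auto simp: n_def degree_pderiv)
  have eq: "rl_left_int c (poly P) s = (\<Sum>i\<le>n. ?a i * s powr (real (Suc i) + c))" if "s \<in> {0<..}" for s
    using rl_left_int_poly[OF assms(1) _ dg(1), of s] that
    by (simp only: sum.atMost_Suc_shift c0) simp
  have "((\<lambda>s. \<Sum>i\<le>n. ?a i * s powr (real (Suc i) + c)) has_real_derivative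
      (\<Sum>i\<le>n. ?a i * ((real (Suc i) + c) * t powr (real i + c)))) (at t)"
  proof (rule DERIV_sum, rule DERIV_cmult)
    fix i
    show "((\<lambda>s. s powr (real (Suc i) + c)) has_real_derivative (real (Suc i) + c) * t powr (real i + c)) (at t)"
      using has_real_derivative_powr[OF assms(2), of "real (Suc i) + c"] by (simp add: algebra_simps)
  qed
  also have "(\<Sum>i\<le>n. ?a i * ((real (Suc i) + c) * t powr (real i + c))) = rl_left_int c (poly (pderiv P)) t"
    unfolding rl_left_int_poly[OF assms(1) less_imp_le[OF assms(2)] dg(2)]
  proof (rule sum.cong[OF refl])
    fix i
    have 1: "Gamma (real (Suc i) + 1) = real (Suc i) * Gamma (real i + 1)"
      using Gamma_plus1[of "real i + 1"] by (auto simp: nonpos_Ints_def add.commute)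
    have 2: "Gamma (real (Suc i) + 1 + c) = (real (Suc i) + c) * Gamma (real i + 1 + c)"
    proof -
      have "real i + 1 + c \<notin> \<int>\<^sub>\<le>\<^sub>0"
        using assms(1) by (auto elim!: nonpos_Ints_cases)
      from Gamma_plus1[OF this] show ?thesis by (simp add: add_ac)
    qed
    have cancel: "x * (A * g / (B * h)) * (B * z) = A * x * (g / h) * z" if "B \<noteq> 0" for x A g B h z :: real
      using that by simp
    show "?a i * ((real (Suc i) + c) * t powr (real i + c)) =
        coeff (pderiv P) i * (Gamma (real i + 1) / Gamma (real i + 1 + c)) * t powr (real i + c)"
      unfolding coeff_pderiv 1 2 by (rule cancel) (use assms(1) in simp)
  qed
  finally show ?thesis
    by (rule has_field_derivative_transform_within_open[OF _ open_greaterThan[of 0]])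
      (use assms(2) eq in auto)
qed

lemma continuous_on_rl_left_int_poly:
  assumes "0 < c"
  shows "continuous_on {0..} (rl_left_int c (poly P))"
proof -
  have "continuous_on {0..} (\<lambda>t. \<Sum>i\<le>degree P. coeff P i *
      (Gamma (real i + 1) / Gamma (real i + 1 + c)) * t powr (real i + c))"
    using assms by (intro continuous_on_sum continuous_on_mult continuous_on_const continuous_on_powr' continuous_on_id) auto
  then show ?thesis
    by (rule continuous_on_eq) (use rl_left_int_poly[OF assms, of _ P "degree P"] in auto)
qed

section \<open>Polynomials as elements of the fractional space\<close>

text \<open>A change at one point affects neither measurability nor integrals. The value at 0 is
  left free because the formula for the fractional derivative of a polynomial is available for
  \<open>t > 0\<close> only.\<close>

lemma in_Lp_if_eq_continuous:
  assumes "p > 0" and g: "continuous_on {0..T} g" and eq: "\<And>t. t \<in> {0<..T} \<Longrightarrow> h t = g t"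
  shows "in_Lp T p h"
proof -
  have mg: "set_borel_measurable lebesgue {0..T} g"
    using borel_measurable_continuous_on_indicator[OF _ g]
    by (auto simp: set_borel_measurable_def intro: measurable_completion)
  have "(\<lambda>t. indicator {0..T} t *\<^sub>R g t + indicator ({0..T} \<inter> {0}) t * (h 0 - g 0)) \<in> borel_measurable lebesgue"
    using mg unfolding set_borel_measurable_def
    by (intro borel_measurable_add borel_measurable_times borel_measurable_indicator borel_measurable_const) auto
  also have "(\<lambda>t. indicator {0..T} t *\<^sub>R g t + indicator ({0..T} \<inter> {0}) t * (h 0 - g 0)) =
      (\<lambda>t. indicator {0..T} t *\<^sub>R h t)"
    using eq by (force simp: indicator_def fun_eq_iff)
  finally have mh: "(\<lambda>t. indicator {0..T} t *\<^sub>R h t) \<in> borel_measurable lebesgue" .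
  have "continuous_on {0..T} (\<lambda>t. \<bar>g t\<bar> powr p)"
    using \<open>p > 0\<close> by (intro continuous_on_powr' continuous_intros g) auto
  then have "set_integrable lebesgue {0..T} (\<lambda>t. \<bar>g t\<bar> powr p)"
    by (intro absolutely_integrable_continuous_real)
  moreover have "AE t in lebesgue. t \<noteq> (0::real)"
    by (rule AE_I'[of "{0}"]) (auto simp: null_sets_completionI)
  then have "AE t in lebesgue. indicator {0..T} t *\<^sub>R \<bar>g t\<bar> powr p = indicator {0..T} t *\<^sub>R \<bar>h t\<bar> powr p"
    by eventually_elim (use eq in \<open>auto simp: indicator_def\<close>)
  moreover have "(\<lambda>t. indicator {0..T} t *\<^sub>R \<bar>h t\<bar> powr p) \<in> borel_measurable lebesgue"
  proof -
    have "(\<lambda>t. indicator {0..T} t * \<bar>indicator {0..T} t *\<^sub>R h t\<bar> powr p) \<in> borel_measurable lebesgue"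
      using measurable_compose[OF mh, of "\<lambda>x. \<bar>x\<bar> powr p" borel]
      by (intro borel_measurable_times borel_measurable_indicator) auto
    also have "(\<lambda>t. indicator {0..T} t * \<bar>indicator {0..T} t *\<^sub>R h t\<bar> powr p) =
        (\<lambda>t. indicator {0..T} t *\<^sub>R \<bar>h t\<bar> powr p)"
      by (auto simp: indicator_def)
    finally show ?thesis .
  qed
  ultimately have "set_integrable lebesgue {0..T} (\<lambda>t. \<bar>h t\<bar> powr p)"
    unfolding set_integrable_def by (blast intro: integrable_cong_AE_imp)
  then show ?thesis using mh by (simp add: in_Lp_def set_borel_measurable_def)
qed


lemma rl_left_deriv_poly:
  assumes "\<alpha> < 1" "0 < t" "poly P 0 = 0"
  shows "rl_left_deriv \<alpha> (poly P) t = rl_left_int (1 - \<alpha>) (poly (pderiv P)) t"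
  unfolding rl_left_deriv_def
  using has_real_derivative_rl_left_int_poly[of "1 - \<alpha>" t P] assms by (intro DERIV_imp_deriv) auto

lemma poly_in_C0_infinity:
  assumes "poly P 0 = 0" "poly P T = 0"
  shows "poly P \<in> C0_infinity T"
proof -
  have "(poly ((pderiv ^^ n) P) has_real_derivative poly ((pderiv ^^ Suc n) P) t) (at t within {0..T})" for n t
    using poly_DERIV[of "(pderiv ^^ n) P" t] by (auto intro: has_field_derivative_at_within)
  then show ?thesis
    using assms unfolding C0_infinity_def
    by (auto intro!: exI[of _ "\<lambda>n. poly ((pderiv ^^ n) P)"])
qed

text \<open>Such a polynomial lies in \<open>C0_infinity T\<close> and approximates itself with
  error 0, so only the integrability and differentiability conditions need work. The point
  \<open>t = 0\<close> is discarded as a null set.\<close>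

lemma poly_in_frac_space:
  assumes "0 < p" "\<alpha> < 1" "poly P 0 = 0" "poly P T = 0"
  shows "poly P \<in> frac_space T \<alpha> p"
proof -
  have "in_Lp T p (poly P)"
    using assms(1) by (rule in_Lp_if_eq_continuous[where g = "poly P"]) (simp_all add: continuous_at_imp_continuous_on)
  moreover have "rl_left_differentiable \<alpha> (poly P) t" if "0 < t" for t
    unfolding rl_left_differentiable_def
    using set_integrable_rl_kernel_poly[of "1 - \<alpha>" _ P]
      has_real_derivative_rl_left_int_poly[of "1 - \<alpha>" t P] assms that
    by (auto simp: real_differentiable_def)
  then have "AE t in lebesgue. t \<in> {0..T} \<longrightarrow> rl_left_differentiable \<alpha> (poly P) t"
    by (intro AE_I'[of "{0}"]) (force simp: null_sets_completionI)+
  moreover have "in_Lp T p (rl_left_deriv \<alpha> (poly P))"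
  proof (rule in_Lp_if_eq_continuous[OF assms(1)])
    show "continuous_on {0..T} (rl_left_int (1 - \<alpha>) (poly (pderiv P)))"
      using assms(2) by (intro continuous_on_subset[OF continuous_on_rl_left_int_poly]) auto
  qed (use assms in \<open>simp add: rl_left_deriv_poly\<close>)
  moreover have "rl_left_int (1 - \<alpha>) (\<lambda>t. 0) = (\<lambda>_. 0)"
    by (simp add: fun_eq_iff rl_left_int_def set_lebesgue_integral_def)
  then have "frac_norm T \<alpha> p (\<lambda>t. poly P t - poly P t) = 0"
    by (simp add: frac_norm_def rl_left_deriv_def set_lebesgue_integral_def)
  then have "\<forall>\<epsilon>>0. \<exists>\<phi>\<in>C0_infinity T. frac_norm T \<alpha> p (\<lambda>t. poly P t - \<phi> t) < \<epsilon>"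
    using poly_in_C0_infinity[OF assms(3,4)] by (intro allI impI bexI[of _ "poly P"]) simp_all
  ultimately show ?thesis by (simp add: frac_space_def)
qed

subsection \<open>Right fractional integrals of signed powers\<close>

text \<open>A weighted Young inequality without sharp constants, by comparing \<open>a\<close> with
  \<open>\<epsilon> * d\<close>. A small \<epsilon> controls the term in \<open>d\<close>; the large
  factor in front of the term in \<open>a\<close> is later compensated by shrinking the domain of
  integration.\<close>

lemma mult_powr_le_scaled_powr:
  fixes a d p \<epsilon> :: real
  assumes "1 < p" "0 < \<epsilon>" "0 \<le> a" "0 \<le> d"
  shows "a * d powr (p - 1) \<le> \<epsilon> powr (1 - p) * a powr p + \<epsilon> * d powr p"
proof (cases "a \<le> \<epsilon> * d")
  case True
  have "a * d powr (p - 1) \<le> \<epsilon> * d * d powr (p - 1)"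
    using True by (intro mult_right_mono) auto
  also have "\<dots> = \<epsilon> * d powr p"
    using assms powr_mult_base[of d "p - 1"] by (simp add: mult.assoc)
  finally show ?thesis by (simp add: add_increasing)
next
  case False
  then have "a > 0" using assms by (meson mult_nonneg_nonneg not_le order.strict_trans1 less_imp_le)
  have "d \<le> a / \<epsilon>" using False assms by (simp add: field_simps)
  then have "a * d powr (p - 1) \<le> a * (a / \<epsilon>) powr (p - 1)"
    using assms by (intro mult_left_mono powr_mono2) auto
  also have "\<dots> = \<epsilon> powr (1 - p) * a powr p"
    using \<open>a > 0\<close> assms by (simp add: powr_divide powr_diff)
  finally show ?thesis using assms by (simp add: add_increasing2)
qed

lemma abs_signed_power: "\<bar>signed_power p x\<bar> = \<bar>x\<bar> powr (p - 1)"
  using powr_mult_base[of "\<bar>x\<bar>" "p - 2"] by (simp add: signed_power_def abs_mult mult.commute)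

lemma borel_measurable_signed_power [measurable]: "signed_power p \<in> borel_measurable borel"
  unfolding signed_power_def by measurable

text \<open>The inequality above with \<open>a = 1\<close> bounds the absolute value by
  \<open>1 + \<bar>d s\<bar> powr p\<close>, which is integrable on a bounded interval.\<close>

lemma set_integrable_signed_power:
  assumes "1 < p" "in_Lp T p d"
  shows "set_integrable lebesgue {0..T} (\<lambda>s. signed_power p (d s))"
  unfolding set_integrable_def
proof (rule Bochner_Integration.integrable_bound)
  have m: "(\<lambda>s. indicator {0..T} s *\<^sub>R d s) \<in> borel_measurable lebesgue"
    and i: "integrable lebesgue (\<lambda>s. indicator {0..T} s *\<^sub>R \<bar>d s\<bar> powr p)"
    using assms by (auto simp: in_Lp_def set_borel_measurable_def set_integrable_def)
  have "integrable lebesgue (\<lambda>s. indicator {0..T} s :: real)"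
    by (intro integrable_real_indicator) (auto simp: emeasure_lborel_Icc_eq)
  then show "integrable lebesgue (\<lambda>s. indicator {0..T} s + indicator {0..T} s *\<^sub>R \<bar>d s\<bar> powr p)"
    using i by (rule Bochner_Integration.integrable_add)
  have "(\<lambda>s. signed_power p (indicator {0..T} s *\<^sub>R d s)) \<in> borel_measurable lebesgue"
    using measurable_compose[OF m borel_measurable_signed_power] by simp
  also have "(\<lambda>s. signed_power p (indicator {0..T} s *\<^sub>R d s)) =
      (\<lambda>s. indicator {0..T} s *\<^sub>R signed_power p (d s))"
    by (auto simp: indicator_def signed_power_def)
  finally show "(\<lambda>s. indicator {0..T} s *\<^sub>R signed_power p (d s)) \<in> borel_measurable lebesgue" .
  have "\<bar>signed_power p x\<bar> \<le> 1 + \<bar>x\<bar> powr p" for x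
    using mult_powr_le_scaled_powr[OF assms(1), of 1 1 "\<bar>x\<bar>"] by (simp add: abs_signed_power)
  then show "AE s in lebesgue. norm (indicator {0..T} s *\<^sub>R signed_power p (d s)) \<le>
      norm (indicator {0..T} s + indicator {0..T} s *\<^sub>R \<bar>d s\<bar> powr p)"
    by (auto simp: indicator_def)
qed

text \<open>Dominated convergence: the truncated kernel is bounded by
  \<open>\<delta> powr (- \<alpha>)\<close>, and its only discontinuity, at distance \<delta>,
  affects the single point \<open>s = r + \<delta>\<close>.\<close>

lemma continuous_truncated_kernel_integral:
  fixes W :: "real \<Rightarrow> real"
  assumes W: "integrable lebesgue W" and "0 < \<delta>" "0 \<le> \<alpha>"
  shows "continuous_on UNIV (\<lambda>r. \<integral>s. (if \<delta> \<le> s - r then (s - r) powr (- \<alpha>) else 0) * W s \<partial>lebesgue)"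
proof (rule continuous_on_sequentiallyI)
  fix X r assume X: "X \<longlonglongrightarrow> (r :: real)"
  have [measurable]: "W \<in> borel_measurable lebesgue" using W by auto
  define k where "k x = (if \<delta> \<le> x then x powr (- \<alpha>) else 0)" for x :: real
  have [measurable]: "k \<in> borel_measurable borel" unfolding k_def by measurable
  have kb: "\<bar>k x\<bar> \<le> \<delta> powr (- \<alpha>)" for x
    using assms by (auto simp: k_def intro: powr_mono2')
  have kc: "isCont k x" if "x \<noteq> \<delta>" for x
  proof (cases "\<delta> < x")
    case True
    have "isCont (\<lambda>x. x powr (- \<alpha>)) x" using True assms by (intro continuous_intros) auto
    moreover have "\<forall>\<^sub>F y in nhds x. k y = y powr (- \<alpha>)"
      by (intro eventually_mono[OF eventually_nhds_in_open[of "{\<delta><..}" x]]) (use True in \<open>auto simp: k_def\<close>)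
    ultimately show ?thesis by (simp add: isCont_cong)
  next
    case False
    have "\<forall>\<^sub>F y in nhds x. k y = 0"
      by (intro eventually_mono[OF eventually_nhds_in_open[of "{..<\<delta>}" x]]) (use False that in \<open>auto simp: k_def\<close>)
    then show ?thesis by (simp add: isCont_cong)
  qed
  have "(\<lambda>n. \<integral>s. k (s - X n) * W s \<partial>lebesgue) \<longlonglongrightarrow> (\<integral>s. k (s - r) * W s \<partial>lebesgue)"
  proof (rule integral_dominated_convergence)
    show "integrable lebesgue (\<lambda>s. \<delta> powr (- \<alpha>) * \<bar>W s\<bar>)" using W by auto
    have "AE s in lebesgue. s \<noteq> r + \<delta>"
      by (rule AE_I'[of "{r + \<delta>}"]) (auto simp: null_sets_completionI)
    then show "AE s in lebesgue. (\<lambda>n. k (s - X n) * W s) \<longlonglongrightarrow> k (s - r) * W s"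
    proof eventually_elim
      fix s assume "s \<noteq> r + \<delta>"
      then have "isCont k (s - r)" by (intro kc) auto
      then have "(\<lambda>n. k (s - X n)) \<longlonglongrightarrow> k (s - r)"
        by (rule isCont_tendsto_compose) (intro tendsto_intros X)
      then show "(\<lambda>n. k (s - X n) * W s) \<longlonglongrightarrow> k (s - r) * W s" by (intro tendsto_intros)
    qed
    show "AE s in lebesgue. norm (k (s - X n) * W s) \<le> \<delta> powr (- \<alpha>) * \<bar>W s\<bar>" for n
      using kb by (auto simp: abs_mult intro!: mult_right_mono)
  qed measurable
  then show "(\<lambda>n. \<integral>s. (if \<delta> \<le> s - X n then (s - X n) powr (- \<alpha>) else 0) * W s \<partial>lebesgue)
      \<longlonglongrightarrow> (\<integral>s. (if \<delta> \<le> s - r then (s - r) powr (- \<alpha>) else 0) * W s \<partial>lebesgue)"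
    by (simp add: k_def)
qed


lemma set_integrable_shifted_powr:
  fixes r c :: real
  assumes "-1 < c"
  shows "set_integrable lebesgue {r..T} (\<lambda>s. (s - r) powr c)"
proof (cases "r \<le> T")
  case True
  have "((\<lambda>x. x powr c) has_integral (T - r) powr (c + 1) / (c + 1)) (cbox 0 (T - r))"
    using True assms has_integral_powr_from_0[of c "T - r"] by simp
  from has_integral_affinity[OF this, of 1 "- r"] True
  have "(\<lambda>s. (s - r) powr c) integrable_on {r..T}"
    by (auto simp: has_integral_integrable)
  then show ?thesis by (intro nonnegative_absolutely_integrable_1) auto
qed (simp add: set_integrable_def)

text \<open>Young's inequality with \<epsilon> = 1 separates the kernel from \<open>d\<close>. The
  resulting power \<open>(s - r) powr (- (\<alpha> * p))\<close> is integrable because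
  \<open>\<alpha> * p < 1\<close>.\<close>

lemma set_integrable_rl_right_kernel:
  assumes "1 < p" "0 < \<alpha>" "\<alpha> * p < 1" "in_Lp T p d" "0 \<le> r"
  shows "set_integrable lebesgue {r..T} (\<lambda>s. (s - r) powr (- \<alpha>) * signed_power p (d s))"
  unfolding set_integrable_def
proof (rule Bochner_Integration.integrable_bound)
  have W: "integrable lebesgue (\<lambda>s. indicator {0..T} s *\<^sub>R signed_power p (d s))"
    using set_integrable_signed_power[OF assms(1,4)] by (simp add: set_integrable_def)
  have "set_integrable lebesgue {0..T} (\<lambda>s. \<bar>d s\<bar> powr p)"
    using assms(4) by (simp add: in_Lp_def)
  then have "set_integrable lebesgue {r..T} (\<lambda>s. \<bar>d s\<bar> powr p)"
    by (rule set_integrable_subset) (use assms(5) in auto)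
  moreover have "set_integrable lebesgue {r..T} (\<lambda>s. (s - r) powr (- (\<alpha> * p)))"
    by (rule set_integrable_shifted_powr) (use assms in simp)
  ultimately show "integrable lebesgue (\<lambda>s. indicator {r..T} s *\<^sub>R (s - r) powr (- (\<alpha> * p)) +
      indicator {r..T} s *\<^sub>R \<bar>d s\<bar> powr p)"
    unfolding set_integrable_def by (rule Bochner_Integration.integrable_add[rotated])
  have m: "(\<lambda>s. (s - r) powr (- \<alpha>)) \<in> borel_measurable lebesgue"
    by (intro measurable_completion) simp
  have "(\<lambda>s. (indicator {r..T} s * (s - r) powr (- \<alpha>)) * (indicator {0..T} s *\<^sub>R signed_power p (d s)))
      \<in> borel_measurable lebesgue"
    by (intro borel_measurable_times borel_measurable_indicator m borel_measurable_integrable[OF W]) simp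
  also have "(\<lambda>s. (indicator {r..T} s * (s - r) powr (- \<alpha>)) * (indicator {0..T} s *\<^sub>R signed_power p (d s))) =
      (\<lambda>s. indicator {r..T} s *\<^sub>R ((s - r) powr (- \<alpha>) * signed_power p (d s)))"
    using assms(5) by (auto simp: indicator_def)
  finally show "(\<lambda>s. indicator {r..T} s *\<^sub>R ((s - r) powr (- \<alpha>) * signed_power p (d s))) \<in> borel_measurable lebesgue" .
  have "(s - r) powr (- \<alpha>) * \<bar>d s\<bar> powr (p - 1) \<le> (s - r) powr (- (\<alpha> * p)) + \<bar>d s\<bar> powr p" for s
    using mult_powr_le_scaled_powr[OF assms(1), of 1 "(s - r) powr (- \<alpha>)" "\<bar>d s\<bar>"] by (simp add: powr_powr)
  then show "AE s in lebesgue. norm (indicator {r..T} s *\<^sub>R ((s - r) powr (- \<alpha>) * signed_power p (d s))) \<le>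
      norm (indicator {r..T} s *\<^sub>R (s - r) powr (- (\<alpha> * p)) + indicator {r..T} s *\<^sub>R \<bar>d s\<bar> powr p)"
    by (auto simp: indicator_def abs_mult abs_signed_power)
qed

text \<open>
  The kernel is cut off at distance \<open>\<delta>\<close> from its singularity. The error is uniformly small,
  because the kernel is in \<open>L\<^sup>p\<close> near its singularity.
\<close>

lemma continuous_on_rl_right_kernel:
  assumes "1 < p" "0 < \<alpha>" "\<alpha> * p < 1" "in_Lp T p d"
  shows "continuous_on {0..T} (\<lambda>r. LINT s:{r..T}|lebesgue. (s - r) powr (- \<alpha>) * signed_power p (d s))"
proof -
  define W where "W s = indicator {0..T} s *\<^sub>R signed_power p (d s)" for s
  define D where "D s = indicator {0..T} s *\<^sub>R \<bar>d s\<bar> powr p" for s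
  have W: "integrable lebesgue W"
    using set_integrable_signed_power[OF assms(1,4)] by (simp add: set_integrable_def W_def[abs_def])
  have D: "integrable lebesgue D"
    using assms(4) by (simp add: in_Lp_def set_integrable_def D_def[abs_def])
  have D0: "0 \<le> (\<integral>s. D s \<partial>lebesgue)" by (intro Bochner_Integration.integral_nonneg) (auto simp: D_def)
  have [measurable]: "W \<in> borel_measurable lebesgue" using W by auto
  define J where "J r = (LINT s:{r..T}|lebesgue. (s - r) powr (- \<alpha>) * signed_power p (d s))" for r
  \<comment> \<open>\<open>k \<delta>\<close> is the kernel cut off below \<delta>. The case
    \<open>k 0\<close> is the full kernel restricted to nonnegative arguments, so that it yields
    \<open>J\<close> itself.\<close>
  define k where "k \<delta> x = (if \<delta> \<le> x then x powr (- \<alpha>) else 0)" for \<delta> x :: real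
  define F where "F \<delta> r = (\<integral>s. k \<delta> (s - r) * W s \<partial>lebesgue)" for \<delta> r
  have km [measurable]: "k \<delta> \<in> borel_measurable borel" for \<delta> unfolding k_def by measurable
  have F_int: "integrable lebesgue (\<lambda>s. k \<delta> (s - r) * W s)" if "0 < \<delta>" for \<delta> r
  proof (rule Bochner_Integration.integrable_bound)
    show "integrable lebesgue (\<lambda>s. \<delta> powr (- \<alpha>) * W s)" using W by auto
    have "\<bar>k \<delta> x\<bar> \<le> \<delta> powr (- \<alpha>)" for x
      using assms that by (auto simp: k_def intro: powr_mono2')
    then show "AE s in lebesgue. norm (k \<delta> (s - r) * W s) \<le> norm (\<delta> powr (- \<alpha>) * W s)"
      by (auto simp: abs_mult intro!: mult_right_mono)
  qed measurable
  have J_eq: "J r = (\<integral>s. k 0 (s - r) * W s \<partial>lebesgue)"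
    and J_int: "integrable lebesgue (\<lambda>s. k 0 (s - r) * W s)" if "r \<in> {0..T}" for r
  proof -
    have *: "k 0 (s - r) * W s = indicator {r..T} s *\<^sub>R ((s - r) powr (- \<alpha>) * signed_power p (d s))" for s
      using that by (auto simp: k_def W_def indicator_def)
    show "J r = (\<integral>s. k 0 (s - r) * W s \<partial>lebesgue)"
      by (simp only: * J_def set_lebesgue_integral_def)
    show "integrable lebesgue (\<lambda>s. k 0 (s - r) * W s)"
      using set_integrable_rl_right_kernel[OF assms, of r] that by (simp only: * set_integrable_def) simp
  qed
  \<comment> \<open>Only \<open>s\<close> between \<open>r\<close> and \<open>r + \<delta>\<close>
    contribute to the error. The first term is a multiple of the integral of the \<open>p\<close>-th
    power of the kernel over \<open>{0..\<delta>}\<close>; neither term depends on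
    \<open>r\<close>.\<close>
  have est: "\<bar>J r - F \<delta> r\<bar> \<le>
      \<epsilon> powr (1 - p) * (\<delta> powr (1 - \<alpha> * p) / (1 - \<alpha> * p)) + \<epsilon> * (\<integral>s. D s \<partial>lebesgue)"
    if "r \<in> {0..T}" "0 < \<delta>" "0 < \<epsilon>" for r \<delta> \<epsilon>
  proof -
    define q where "q x = indicator {0..\<delta>} x * x powr (- (\<alpha> * p))" for x :: real
    have qb [measurable]: "q \<in> borel_measurable borel" unfolding q_def by measurable
    have "((\<lambda>x. x powr (- (\<alpha> * p))) has_integral (\<delta> powr (- (\<alpha> * p) + 1) / (- (\<alpha> * p) + 1))) {0..\<delta>}"
      using assms that by (intro has_integral_powr_from_0) auto
    moreover have *: "set_integrable lebesgue {0..\<delta>} (\<lambda>x. x powr (- (\<alpha> * p)))"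
      using set_integrable_shifted_powr[of "- (\<alpha> * p)" 0 \<delta>] assms by simp
    ultimately have "(LINT x:{0..\<delta>}|lebesgue. x powr (- (\<alpha> * p))) = \<delta> powr (1 - \<alpha> * p) / (1 - \<alpha> * p)"
      using set_lebesgue_integral_eq_integral(2)[OF *] by (simp add: integral_unique)
    then have q_val: "(\<integral>x. q x \<partial>lborel) = \<delta> powr (1 - \<alpha> * p) / (1 - \<alpha> * p)"
      using qb by (simp add: set_lebesgue_integral_def q_def[abs_def] integral_completion)
    have "integrable lborel q"
      using * qb by (simp add: set_integrable_def q_def[abs_def] integrable_completion)
    from lborel_integrable_real_affine[OF this, of 1 "- r"]
    have q_int: "integrable lebesgue (\<lambda>s. q (s - r))" by (simp add: integrable_completion)
    have q_eq: "(\<integral>s. q (s - r) \<partial>lebesgue) = (\<integral>x. q x \<partial>lborel)"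
      using lborel_integral_real_affine[of 1 q "- r"] by (simp add: integral_completion)
    have pt: "\<bar>k 0 (s - r) * W s - k \<delta> (s - r) * W s\<bar> \<le> \<epsilon> powr (1 - p) * q (s - r) + \<epsilon> * D s" for s
    proof (cases "s \<in> {0..T} \<and> s - r \<in> {0..<\<delta>}")
      case True
      have "(s - r) powr (- \<alpha>) * \<bar>d s\<bar> powr (p - 1) \<le>
          \<epsilon> powr (1 - p) * (s - r) powr (- (\<alpha> * p)) + \<epsilon> * \<bar>d s\<bar> powr p"
        using mult_powr_le_scaled_powr[OF assms(1) \<open>0 < \<epsilon>\<close>, of "(s - r) powr (- \<alpha>)" "\<bar>d s\<bar>"]
        by (simp add: powr_powr)
      then show ?thesis using True
        by (auto simp: k_def W_def q_def D_def abs_mult abs_signed_power)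
    next
      case False
      then have z: "k 0 (s - r) * W s - k \<delta> (s - r) * W s = 0" using \<open>0 < \<delta>\<close> by (auto simp: k_def W_def)
      moreover have "0 \<le> \<epsilon> powr (1 - p) * q (s - r) + \<epsilon> * D s"
        using \<open>0 < \<epsilon>\<close> by (auto simp: q_def D_def)
      ultimately show ?thesis unfolding z by simp
    qed
    have "\<bar>J r - F \<delta> r\<bar> = \<bar>\<integral>s. k 0 (s - r) * W s - k \<delta> (s - r) * W s \<partial>lebesgue\<bar>"
      using J_int[OF that(1)] F_int[OF that(2)] by (simp add: J_eq[OF that(1)] F_def)
    also have "\<dots> \<le> (\<integral>s. \<bar>k 0 (s - r) * W s - k \<delta> (s - r) * W s\<bar> \<partial>lebesgue)"
      by (rule integral_abs_bound)
    also have "\<dots> \<le> (\<integral>s. \<epsilon> powr (1 - p) * q (s - r) + \<epsilon> * D s \<partial>lebesgue)"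
      using J_int[OF that(1)] F_int[OF that(2)] q_int D pt by (intro integral_mono) auto
    also have "\<dots> = \<epsilon> powr (1 - p) * (\<integral>x. q x \<partial>lborel) + \<epsilon> * (\<integral>s. D s \<partial>lebesgue)"
      using q_int D by (simp add: q_eq)
    finally show ?thesis by (simp add: q_val)
  qed
  have "uniform_limit {0..T} F J (at_right 0)"
  proof (rule uniform_limitI)
    fix e :: real assume "0 < e"
    \<comment> \<open>First \<epsilon> is fixed to make the second error term less than
      \<open>e / 2\<close>, then \<delta> tends to 0. The summand 1 guards against a vanishing
      integral of \<open>D\<close>.\<close>
    define \<epsilon> where "\<epsilon> = e / (2 * ((\<integral>s. D s \<partial>lebesgue) + 1))"
    have \<epsilon>: "0 < \<epsilon>" using \<open>0 < e\<close> D0 by (simp add: \<epsilon>_def)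
    have small: "\<epsilon> * (\<integral>s. D s \<partial>lebesgue) < e / 2"
      using \<open>0 < e\<close> D0 by (simp add: \<epsilon>_def field_simps)
    have "((\<lambda>\<delta>. \<epsilon> powr (1 - p) * (\<delta> powr (1 - \<alpha> * p) / (1 - \<alpha> * p))) \<longlongrightarrow>
        \<epsilon> powr (1 - p) * (0 powr (1 - \<alpha> * p) / (1 - \<alpha> * p))) (at_right 0)"
      using assms by (intro tendsto_intros tendsto_powr') (auto simp: eventually_at_filter)
    then have "\<forall>\<^sub>F \<delta> in at_right 0. \<epsilon> powr (1 - p) * (\<delta> powr (1 - \<alpha> * p) / (1 - \<alpha> * p)) < e / 2"
      using \<open>0 < e\<close> by (intro order_tendstoD(2)[where y = 0]) auto
    moreover have "\<forall>\<^sub>F \<delta> in at_right 0. 0 < (\<delta> :: real)" by (simp add: eventually_at_filter)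
    ultimately show "\<forall>\<^sub>F \<delta> in at_right 0. \<forall>r\<in>{0..T}. dist (F \<delta> r) (J r) < e"
    proof (eventually_elim, intro ballI)
      fix \<delta> r assume "\<epsilon> powr (1 - p) * (\<delta> powr (1 - \<alpha> * p) / (1 - \<alpha> * p)) < e / 2" "0 < \<delta>" "r \<in> {0..T}"
      then have "\<bar>J r - F \<delta> r\<bar> < e" using est[of r \<delta> \<epsilon>] \<epsilon> small by linarith
      then show "dist (F \<delta> r) (J r) < e" by (simp add: dist_real_def abs_minus_commute)
    qed
  qed
  moreover have "\<forall>\<^sub>F \<delta> in at_right 0. continuous_on {0..T} (F \<delta>)"
  proof -
    have "continuous_on {0..T} (F \<delta>)" if "0 < \<delta>" for \<delta>
      using continuous_truncated_kernel_integral[OF W that, of \<alpha>] assms(2)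
      by (auto simp: F_def[abs_def] k_def intro: continuous_on_subset)
    then show ?thesis by (simp add: eventually_at_filter)
  qed
  ultimately have "continuous_on {0..T} J"
    by (intro uniform_limit_theorem) auto
  then show ?thesis by (simp add: J_def[abs_def])
qed

subsection \<open>Critical points\<close>

text \<open>Fractional integration by parts: the left derivative of \<open>poly P\<close> is the
  left fractional integral of its ordinary derivative, and Fubini's theorem moves the kernel to the
  other factor.\<close>

lemma LINT_signed_power_mult_rl_left_deriv_poly:
  assumes "1 < p" "\<alpha> < 1" "in_Lp T p d" "poly P 0 = 0"
  shows "(LINT t:{0..T}|lebesgue. signed_power p (d t) * rl_left_deriv \<alpha> (poly P) t) =
    (LINT t:{0..T}|lebesgue. rl_right_int T (1 - \<alpha>) (\<lambda>s. signed_power p (d s)) t * poly (pderiv P) t)"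
proof -
  let ?w = "\<lambda>t. signed_power p (d t)"
  let ?D = "rl_left_int (1 - \<alpha>) (poly (pderiv P))"
  have w: "set_integrable lebesgue {0..T} ?w"
    using set_integrable_signed_power[OF assms(1,3)] .
  have cD: "continuous_on {0..T} ?D"
    using assms(2) by (intro continuous_on_subset[OF continuous_on_rl_left_int_poly]) auto
  \<comment> \<open>Serves both integrands compared below: \<open>?D\<close> itself and the
    fractional derivative, which is known to agree with \<open>?D\<close> for \<open>t > 0\<close>
    only.\<close>
  have meas: "(\<lambda>t. indicator {0..T} t *\<^sub>R (?w t * h t)) \<in> borel_measurable lebesgue"
    if "\<And>t. t \<in> {0<..T} \<Longrightarrow> h t = ?D t" for h
  proof -
    have "in_Lp T p h" using assms(1) by (intro in_Lp_if_eq_continuous[OF _ cD that]) auto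
    then have "(\<lambda>t. (indicator {0..T} t *\<^sub>R ?w t) * (indicator {0..T} t *\<^sub>R h t)) \<in> borel_measurable lebesgue"
      using w unfolding in_Lp_def set_borel_measurable_def set_integrable_def
      by (intro borel_measurable_times) auto
    also have "(\<lambda>t. (indicator {0..T} t *\<^sub>R ?w t) * (indicator {0..T} t *\<^sub>R h t)) =
        (\<lambda>t. indicator {0..T} t *\<^sub>R (?w t * h t))"
      by (auto simp: indicator_def)
    finally show ?thesis .
  qed
  have "(LINT t:{0..T}|lebesgue. ?w t * rl_left_deriv \<alpha> (poly P) t) = (LINT t:{0..T}|lebesgue. ?w t * ?D t)"
    unfolding set_lebesgue_integral_def
  proof (rule integral_cong_AE)
    have "AE t in lebesgue. t \<noteq> (0::real)"
      by (rule AE_I'[of "{0}"]) (auto simp: null_sets_completionI)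
    then show "AE t in lebesgue. indicator {0..T} t *\<^sub>R (?w t * rl_left_deriv \<alpha> (poly P) t) =
        indicator {0..T} t *\<^sub>R (?w t * ?D t)"
      by eventually_elim (use assms in \<open>auto simp: indicator_def rl_left_deriv_poly\<close>)
  qed (intro meas; use assms in \<open>simp add: rl_left_deriv_poly\<close>)+
  also have "\<dots> = 1 / Gamma (1 - \<alpha>) * (LINT t:{0..T}|lebesgue.
      ?w t * (LINT s:{0..t}|lebesgue. (t - s) powr (- \<alpha>) * poly (pderiv P) s))"
    unfolding set_integral_mult_right[symmetric] by (simp add: rl_left_int_def mult_ac)
  also have "(LINT t:{0..T}|lebesgue. ?w t * (LINT s:{0..t}|lebesgue. (t - s) powr (- \<alpha>) * poly (pderiv P) s)) =
      (LINT s:{0..T}|lebesgue. poly (pderiv P) s * (LINT t:{s..T}|lebesgue. (t - s) powr (- \<alpha>) * ?w t))"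
  proof -
    have cb: "continuous_on {0..T} (poly (pderiv P))" by (simp add: continuous_at_imp_continuous_on)
    obtain B where B: "\<And>t. t \<in> {0..T} \<Longrightarrow> \<bar>poly (pderiv P) t\<bar> \<le> B"
      using compact_imp_bounded[OF compact_continuous_image[OF cb compact_Icc]] by (auto simp: bounded_iff simp del: atLeastAtMost_iff)
    have "set_borel_measurable lebesgue {0..T} (poly (pderiv P))"
      using absolutely_integrable_continuous_real[OF cb]
      unfolding set_borel_measurable_def set_integrable_def by (rule borel_measurable_integrable)
    moreover have "set_integrable lebesgue {0..T} (\<lambda>x. x powr (- \<alpha>))"
      using set_integrable_shifted_powr[of "- \<alpha>" 0 T] assms(2) by simp
    ultimately show ?thesis
      by (intro integral_convolution_swap[where k = "\<lambda>x. x powr (- \<alpha>)", OF w _ B]) auto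
  qed
  also have "1 / Gamma (1 - \<alpha>) * \<dots> = (LINT s:{0..T}|lebesgue. 1 / Gamma (1 - \<alpha>) *
      (poly (pderiv P) s * (LINT t:{s..T}|lebesgue. (t - s) powr (- \<alpha>) * ?w t)))"
    by (rule set_integral_mult_right[symmetric])
  also have "\<dots> = (LINT t:{0..T}|lebesgue. rl_right_int T (1 - \<alpha>) ?w t * poly (pderiv P) t)"
    by (simp add: rl_right_int_def mult.commute)
  finally show ?thesis .
qed

theorem lemma1p2:
  fixes T \<alpha> p :: real
    and f :: "real \<Rightarrow> real \<Rightarrow> real"
    and I' :: "(real \<Rightarrow> real) \<Rightarrow> (real \<Rightarrow> real) \<Rightarrow> real"
    and u :: "real \<Rightarrow> real"
  assumes "T > 0" and "1 < p" and "0 < \<alpha>" and "\<alpha> < 1 / p"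
    and "continuous_on ({0..T} \<times> UNIV) (\<lambda>(t, x). f t x)"
    and "\<And>w. w \<in> frac_space T \<alpha> p \<Longrightarrow>
           set_integrable lebesgue {0..T} (\<lambda>t. primitive f t (w t))"
    and "C1_on (frac_space T \<alpha> p) (frac_norm T \<alpha> p) (energy T \<alpha> p f) I'"
    and "\<And>w v. w \<in> frac_space T \<alpha> p \<Longrightarrow> v \<in> frac_space T \<alpha> p \<Longrightarrow>
           set_integrable lebesgue {0..T} (\<lambda>t. f t (w t) * v t)"
    and "\<And>w v. w \<in> frac_space T \<alpha> p \<Longrightarrow> v \<in> frac_space T \<alpha> p \<Longrightarrow>
           I' w v =
             (LINT t:{0..T}|lebesgue. signed_power p (rl_left_deriv \<alpha> w t) * rl_left_deriv \<alpha> v t)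
             - (LINT t:{0..T}|lebesgue. f t (w t) * v t)"
    and "u \<in> frac_space T \<alpha> p"
    and "\<And>v. v \<in> frac_space T \<alpha> p \<Longrightarrow> I' u v = 0"
  shows "ae_solution T \<alpha> p f u"
proof -
  let ?w = "\<lambda>s. signed_power p (rl_left_deriv \<alpha> u s)"
  define J where "J = rl_right_int T (1 - \<alpha>) ?w"
  \<comment> \<open>The factor \<open>[:0, T, -1:]\<close> is the polynomial
    \<open>t * (T - t)\<close>; it makes every \<open>poly (P n)\<close> vanish at both ends and
    hence an admissible test function.\<close>
  define P where "P n = [:0, T, -1:] * monom 1 n" for n
  have ap: "\<alpha> * p < 1" using assms(2,4) by (simp add: field_simps)
  have "\<alpha> < 1" using assms(2,4) by (smt (verit) divide_less_eq_1_pos)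
  have d: "in_Lp T p (rl_left_deriv \<alpha> u)" using assms(10) by (simp add: frac_space_def)
  have poly_P: "poly (P n) t = t * (T - t) * t ^ n" for n t
    by (simp add: P_def poly_monom algebra_simps)
  have poly_P': "poly (pderiv (P n)) t = (T - 2 * t) * t ^ n + t * (T - t) * (real n * t ^ (n - 1))" for n t
    unfolding P_def pderiv_mult pderiv_monom by (simp add: pderiv_pCons poly_monom algebra_simps)
  have P_space: "poly (P n) \<in> frac_space T \<alpha> p" for n
    using assms(2) \<open>\<alpha> < 1\<close> by (intro poly_in_frac_space) (auto simp: poly_P)
  have "continuous_on {0..T} (\<lambda>r. 1 / Gamma (1 - \<alpha>) *
      (LINT s:{r..T}|lebesgue. (s - r) powr (- \<alpha>) * ?w s))"
    using continuous_on_rl_right_kernel[OF assms(2,3) ap d] by (intro continuous_intros)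
  then have contJ: "continuous_on {0..T} J"
    by (rule continuous_on_eq) (simp add: J_def rl_right_int_def)
  have "AE t in lebesgue. t \<in> {0..T} \<longrightarrow>
      t \<in> {0<..<T} \<and> (J has_real_derivative - f t (u t)) (at t)"
  proof (rule AE_has_real_derivative_if_moments[OF assms(1) contJ])
    show "set_integrable lebesgue {0..T} (\<lambda>t. f t (u t) * (t * (T - t)))"
      \<comment> \<open>The test function with \<open>n = 0\<close> is the weight itself.\<close>
      using assms(8)[OF assms(10) P_space[of 0]] by (simp add: poly_P)
    fix n
    have "poly (P n) 0 = 0" by (simp add: poly_P)
    \<comment> \<open>Criticality of \<open>u\<close> equates the integral of \<open>?w\<close>
      times the fractional derivative of \<open>poly (P n)\<close> with that of
      \<open>f t (u t) * poly (P n) t\<close>. Integration by parts rewrites the former in terms of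
      \<open>J\<close>.\<close>
    from LINT_signed_power_mult_rl_left_deriv_poly[OF assms(2) \<open>\<alpha> < 1\<close> d this]
    show "(LINT t:{0..T}|lebesgue. J t * ((T - 2 * t) * t ^ n + t * (T - t) * (real n * t ^ (n - 1)))) =
        (LINT t:{0..T}|lebesgue. f t (u t) * (t * (T - t) * t ^ n))"
      using assms(9)[OF assms(10) P_space[of n]] assms(11)[OF P_space[of n]]
      by (simp add: J_def poly_P poly_P')
  qed
  then have "AE t in lebesgue. t \<in> {0..T} \<longrightarrow>
      rl_right_differentiable T \<alpha> ?w t \<and> rl_right_deriv T \<alpha> ?w t = f t (u t)"
  proof (eventually_elim, intro impI)
    fix t assume "t \<in> {0..T} \<longrightarrow> t \<in> {0<..<T} \<and> (J has_real_derivative - f t (u t)) (at t)" "t \<in> {0..T}"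
    then have t: "0 < t" and der: "(J has_real_derivative - f t (u t)) (at t)" by auto
    \<comment> \<open>As \<open>t\<close> is interior, all \<open>r\<close> near it are positive, so
      the integrability of the kernel on \<open>{r..T}\<close> is available.\<close>
    have "\<forall>\<^sub>F r in nhds t. r \<in> {0<..}" using t by (intro eventually_nhds_in_open) auto
    then have "\<forall>\<^sub>F r in nhds t. set_integrable lebesgue {r..T} (\<lambda>s. (s - r) powr (- \<alpha>) * ?w s)"
      by eventually_elim (intro set_integrable_rl_right_kernel[OF assms(2,3) ap d], simp)
    then show "rl_right_differentiable T \<alpha> ?w t \<and> rl_right_deriv T \<alpha> ?w t = f t (u t)"
      using der DERIV_imp_deriv[OF der]
      by (auto simp: rl_right_differentiable_def rl_right_deriv_def J_def[symmetric] real_differentiable_def)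
  qed
  with assms(10) show ?thesis by (simp add: ae_solution_def)
qed

end
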